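(* Let $(\Omega,\Sigma,\mu)$ be a semi-finite measure space, let $O \subseteq \mathbb{C}^d$ be open and non-empty, and let $f : O \times \Omega \to \mathbb{C}$ be a function with the following properties: \begin{itemize} \item for every $z \in O$ the function $F(z) := f(z,\cdot)$ is measurable, and $\displaystyle \sup_{z \in O} \operatorname*{ess\,sup}_{t \in \Omega} |f(z,t)| < \infty$; \item for every $t \in \Omega$ the function $f_t := f(\cdot,t)$ is bounded and holomorphic on $O$. \end{itemize} Fix $\alpha \in \mathbb{N}_0^d$, $a \in O$, and a bp-continuous linear functional $\varphi : \mathrm{H}^\infty(O) \to \mathbb{C}$. Then the following assertions hold: (a) $F \in \mathrm{H}^\infty(O; \mathrm{L}_\infty(\Omega))$ and $D^\alpha F(a) = D_z^\alpha f(a,\cdot)$ $\mu$-almost everywhere. (b) For each $g \in \mathrm{L}_1(\Omega)$ the function $z \mapsto \int_\Omega f(z,t) g(t)\, \mu(\mathrm{d}t)$ is holomorphic on $O$ and \[ D^\alpha \Bigl( z \mapsto \int_\Omega f(z,t)g(t)\,\mu(\mathrm{d}t) \Bigr)(a) = \int_\Omega D_z^\alpha f(a,t) g(t)\, \mu(\mathrm{d}t). \] (c) The function $t \mapsto \varphi(f_t)$ is measurable and essentially bounded with \[ \operatorname*{ess\,sup}_{t \in \Omega} |\varphi(f_t)| \le \|\varphi\| \sup_{z \in O} \|F(z)\|_{\mathrm{L}_\infty(\Omega)}, \] and it is contained in the $\sigma(\mathrm{L}_\infty,\mathrm{L}_1)$-closure of $\mathrm{span}\,F(O)$ in $\mathrm{L}_\infty(\Omega)$.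 (d) For all $g \in \mathrm{L}_1(\Omega)$: \[ \int_\Omega \varphi(f_t) g(t)\, \mu(\mathrm{d}t) = \varphi\Bigl( z \mapsto \int_\Omega f(z,t) g(t)\, \mu(\mathrm{d}t) \Bigr). \]
   Context: A measure space $(\Omega,\Sigma,\mu)$ is semi-finite if for every $B \in \Sigma$ with $\mu(B) = +\infty$ there exists $A \in \Sigma$, $A \subseteq B$, with $0 < \mu(A) < \infty$. Functions in $\mathrm{L}_1(\Omega)$, $\mathrm{L}_\infty(\Omega)$ are complex-valued and identified when equal $\mu$-almost everywhere; $F(z)$ is regarded as the corresponding element of $\mathrm{L}_\infty(\Omega)$ where appropriate. $\sigma(\mathrm{L}_\infty,\mathrm{L}_1)$ is the coarsest topology on $\mathrm{L}_\infty(\Omega)$ making all functionals $u \mapsto \int_\Omega u g\,\mathrm{d}\mu$, $g \in \mathrm{L}_1(\Omega)$, continuous. A function from an open set $O \subseteq \mathbb{C}^d$ to a complex Banach space $E$ is holomorphic if it is Fréchet-differentiable with $\mathbb{C}$-linear derivative at each point of $O$. $\mathrm{H}^\infty(O;E)$ is the space of all bounded holomorphic functions $O \to E$ with the supremum norm, and $\mathrm{H}^\infty(O) := \mathrm{H}^\infty(O;\mathbb{C})$. For $\alpha \in \mathbb{N}_0^d$, $D^\alpha = \prod_{j=1}^d \partial^{\alpha_j}/\partial z_j^{\alpha_j}$ is the iterated complex partial derivative, and $D_z^\alpha f(a,t) := D^\alpha(f(\cdot,t))(a)$. A sequence $(g_n)_n$ of bounded functions on $O$ bp-converges to $g$ if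 $g_n \to g$ pointwise on $O$ and $\sup_n \|g_n\|_\infty < \infty$. A linear functional $\varphi : \mathrm{H}^\infty(O) \to \mathbb{C}$ is bp-continuous if $\varphi(g_n) \to \varphi(g)$ whenever $(g_n)_n$ is a sequence in $\mathrm{H}^\infty(O)$ that bp-converges to $g \in \mathrm{H}^\infty(O)$. Such a functional is in particular norm-bounded, and $\|\varphi\|$ is its norm as a functional on $\mathrm{H}^\infty(O)$ with the supremum norm. *)

theory Defs
  imports "HOL-Probability.Probability" "HOL-Library.Function_Algebras"
begin

text \<open>
  The library locale \<^locale>\<open>semifinite_measure\<close> does not require the subset to have
  positive measure (so the empty set always works there); hence the explicit definition.
\<close>
definition semi_finite :: "'a measure \<Rightarrow> bool" where
  "semi_finite M \<longleftrightarrow>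
     (\<forall>B\<in>sets M. emeasure M B = \<infinity> \<longrightarrow>
        (\<exists>A\<in>sets M. A \<subseteq> B \<and> 0 < emeasure M A \<and> emeasure M A < \<infinity>))"


subsection \<open>The space of essentially bounded functions\<close>

text \<open>
  Elements of \<open>L\<^sub>\<infinity>\<close> are handled through representing functions, with equality replaced by
  equality almost everywhere; everything below only depends on the classes modulo this
  relation. In \<^typ>\<open>ennreal\<close> the essential supremum is \<open>\<infinity>\<close> for non-measurable functions,
  and \<open>0\<close> (not \<open>-\<infinity>\<close>) if the whole space is null.
\<close>
definition Linf_norm :: "'a measure \<Rightarrow> ('a \<Rightarrow> complex) \<Rightarrow> ennreal" where
  "Linf_norm M u = esssup M (\<lambda>t. ennreal (cmod (u t)))"

definition Linf :: "'a measure \<Rightarrow> ('a \<Rightarrow> complex) set" where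
  "Linf M = {u \<in> borel_measurable M. Linf_norm M u < \<infinity>}"

text \<open>
  The topology \<open>\<sigma>(L\<^sub>\<infinity>, L\<^sub>1)\<close>, pulled back to the representing functions: the coarsest topology
  on \<^term>\<open>Linf M\<close> that makes all functionals \<open>u \<mapsto> \<integral> u g d\<mu>\<close> continuous.
\<close>
definition Linf_weak_topology :: "'a measure \<Rightarrow> ('a \<Rightarrow> complex) topology" where
  "Linf_weak_topology M =
     topology_generated_by
       {{u \<in> Linf M. (\<integral>t. u t * g t \<partial>M) \<in> W} | g W. integrable M g \<and> open W}"

abbreviation complex_span :: "('a \<Rightarrow> complex) set \<Rightarrow> ('a \<Rightarrow> complex) set" where
  "complex_span \<equiv> module.span (\<lambda>(c::complex) u t. c * u t)"

lemma vector_space_complex_fun: "vector_space (\<lambda>(c::complex) u t. c * (u t :: complex))"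
  by standard (auto simp: fun_eq_iff algebra_simps)


subsection \<open>Bounded holomorphic functions of several variables\<close>

text \<open>
  Functions on an open set \<open>U\<close> are total functions of which only the values on \<open>U\<close> matter.
\<close>
definition holomorphic_several :: "(complex ^ 'd) set \<Rightarrow> (complex ^ 'd \<Rightarrow> complex) \<Rightarrow> bool" where
  "holomorphic_several U f \<longleftrightarrow>
     (\<forall>z\<in>U. \<exists>A. (f has_derivative A) (at z) \<and> (\<forall>c v. A (c *s v) = c * A v))"

definition sup_norm :: "(complex ^ 'd) set \<Rightarrow> (complex ^ 'd \<Rightarrow> complex) \<Rightarrow> ennreal" where
  "sup_norm U f = (SUP z\<in>U. ennreal (cmod (f z)))"

definition Hinf :: "(complex ^ 'd) set \<Rightarrow> (complex ^ 'd \<Rightarrow> complex) set" where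
  "Hinf U = {f. holomorphic_several U f \<and> sup_norm U f < \<infinity>}"

text \<open>\<open>A\<close> is the Frechet derivative at \<open>z\<close> of the \<open>L\<^sub>\<infinity>\<close>-valued function \<open>F\<close>, and it is
  a bounded \<open>\<complex>\<close>-linear map into \<open>L\<^sub>\<infinity>\<close>.\<close>
definition has_Linf_derivative ::
    "'a measure \<Rightarrow> (complex ^ 'd \<Rightarrow> 'a \<Rightarrow> complex) \<Rightarrow> (complex ^ 'd \<Rightarrow> 'a \<Rightarrow> complex)
      \<Rightarrow> complex ^ 'd \<Rightarrow> bool" where
  "has_Linf_derivative M F A z \<longleftrightarrow>
     (\<forall>v. A v \<in> Linf M) \<and>
     (\<forall>v w. AE t in M. A (v + w) t = A v t + A w t) \<and>
     (\<forall>c v. AE t in M. A (c *s v) t = c * A v t) \<and>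
     (\<exists>C::real. \<forall>v. Linf_norm M (A v) \<le> ennreal (C * norm v)) \<and>
     ((\<lambda>h. Linf_norm M (\<lambda>t. F (z + h) t - F z t - A h t) / ennreal (norm h)) \<longlongrightarrow> 0) (at 0)"

definition Hinf_Linf ::
    "'a measure \<Rightarrow> (complex ^ 'd) set \<Rightarrow> (complex ^ 'd \<Rightarrow> 'a \<Rightarrow> complex) set" where
  "Hinf_Linf M U =
     {F. (\<forall>z\<in>U. F z \<in> Linf M) \<and> (\<forall>z\<in>U. \<exists>A. has_Linf_derivative M F A z) \<and>
         (SUP z\<in>U. Linf_norm M (F z)) < \<infinity>}"


subsection \<open>Iterated partial derivatives\<close>

definition partial_deriv ::
    "'d \<Rightarrow> (complex ^ 'd \<Rightarrow> complex) \<Rightarrow> complex ^ 'd \<Rightarrow> complex" where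
  "partial_deriv j f z = deriv (\<lambda>w. f (z + axis j w)) 0"

text \<open>The limit of the difference quotients in \<open>L\<^sub>\<infinity>\<close> is unique up to equality almost
  everywhere, so the choice only concerns the representing function.\<close>
definition Linf_partial_deriv ::
    "'a measure \<Rightarrow> 'd \<Rightarrow> (complex ^ 'd \<Rightarrow> 'a \<Rightarrow> complex) \<Rightarrow> complex ^ 'd \<Rightarrow> 'a \<Rightarrow> complex" where
  "Linf_partial_deriv M j F z =
     (SOME h. h \<in> Linf M \<and>
        ((\<lambda>w. Linf_norm M (\<lambda>t. (F (z + axis j w) t - F z t) / w - h t)) \<longlongrightarrow> 0) (at 0))"

text \<open>
  For \<open>d = CARD('d)\<close> and \<open>j\<^sub>1 < \<dots> < j\<^sub>d\<close> the elements of \<^typ>\<open>'d\<close>, this is the operator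
  \<open>P j\<^sub>1 ^ \<alpha> j\<^sub>1 \<circ> \<dots> \<circ> P j\<^sub>d ^ \<alpha> j\<^sub>d\<close>. The order on the coordinates is only used to fix
  the order of composition.
\<close>
definition iterate_partials ::
    "('d::{finite,linorder} \<Rightarrow> 'f \<Rightarrow> 'f) \<Rightarrow> ('d \<Rightarrow> nat) \<Rightarrow> 'f \<Rightarrow> 'f" where
  "iterate_partials P \<alpha> = foldr (\<lambda>j. P j ^^ \<alpha> j) (sorted_list_of_set UNIV)"

definition Dmulti ::
    "('d::{finite,linorder} \<Rightarrow> nat) \<Rightarrow> ((complex, 'd) vec \<Rightarrow> complex) \<Rightarrow> (complex, 'd) vec \<Rightarrow> complex" where
  "Dmulti = iterate_partials partial_deriv"

definition Linf_Dmulti ::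
    "'a measure \<Rightarrow> ('d::{finite,linorder} \<Rightarrow> nat) \<Rightarrow> ((complex, 'd) vec \<Rightarrow> 'a \<Rightarrow> complex)
      \<Rightarrow> (complex, 'd) vec \<Rightarrow> 'a \<Rightarrow> complex" where
  "Linf_Dmulti M = iterate_partials (Linf_partial_deriv M)"


subsection \<open>bp-continuous functionals\<close>

definition bp_converges ::
    "(complex ^ 'd) set \<Rightarrow> (nat \<Rightarrow> complex ^ 'd \<Rightarrow> complex) \<Rightarrow> (complex ^ 'd \<Rightarrow> complex) \<Rightarrow> bool" where
  "bp_converges U G g \<longleftrightarrow>
     (\<forall>z\<in>U. (\<lambda>n. G n z) \<longlonglongrightarrow> g z) \<and> (SUP n. sup_norm U (G n)) < \<infinity>"

text \<open>The first condition says that a functional only sees the values on \<open>U\<close>.\<close>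
definition Hinf_functional ::
    "(complex ^ 'd) set \<Rightarrow> ((complex ^ 'd \<Rightarrow> complex) \<Rightarrow> complex) \<Rightarrow> bool" where
  "Hinf_functional U \<phi> \<longleftrightarrow>
     (\<forall>g\<in>Hinf U. \<forall>h\<in>Hinf U. (\<forall>z\<in>U. g z = h z) \<longrightarrow> \<phi> g = \<phi> h) \<and>
     (\<forall>g\<in>Hinf U. \<forall>h\<in>Hinf U. \<phi> (\<lambda>z. g z + h z) = \<phi> g + \<phi> h) \<and>
     (\<forall>c. \<forall>g\<in>Hinf U. \<phi> (\<lambda>z. c * g z) = c * \<phi> g)"

definition bp_continuous ::
    "(complex ^ 'd) set \<Rightarrow> ((complex ^ 'd \<Rightarrow> complex) \<Rightarrow> complex) \<Rightarrow> bool" where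
  "bp_continuous U \<phi> \<longleftrightarrow>
     (\<forall>G g. (\<forall>n. G n \<in> Hinf U) \<longrightarrow> g \<in> Hinf U \<longrightarrow> bp_converges U G g \<longrightarrow>
        (\<lambda>n. \<phi> (G n)) \<longlonglongrightarrow> \<phi> g)"

definition functional_norm ::
    "(complex ^ 'd) set \<Rightarrow> ((complex ^ 'd \<Rightarrow> complex) \<Rightarrow> complex) \<Rightarrow> ennreal" where
  "functional_norm U \<phi> = (SUP g\<in>{g\<in>Hinf U. sup_norm U g \<le> 1}. ennreal (cmod (\<phi> g)))"

end

theory Submission
  imports Defs "HOL-Complex_Analysis.Cauchy_Integral_Formula"
begin

text \<open>
  Two facts carry the proof.

  The first is that Cauchy's estimates are uniform: for holomorphic \<open>g\<close> with \<open>\<bar>g\<bar> \<le> C\<close> on a ball of radius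
  \<open>r\<close> about \<open>z\<close> the Taylor remainder satisfies \<open>\<bar>g (z + h) - g z - g'(z) h\<bar> \<le> 8 C \<parallel>h\<parallel>\<^sup>2 / r\<^sup>2\<close>
  (\<open>holomorphic_remainder_bound\<close>). By continuity in \<open>z\<close> and a countable dense subset of \<open>U\<close>, almost all
  \<open>f\<^sub>t\<close> are bounded on \<open>U\<close> by the same constant. Hence the remainder is uniform in \<open>t\<close>, and it may be read
  as differentiability in \<open>L\<^sub>\<infinity>\<close> or be integrated against \<open>g \<in> L\<^sub>1\<close>. This settles
  first derivatives, both of \<open>F\<close> and of the integrals against \<open>g\<close>. To iterate, one needs that directional derivatives of Frechet holomorphic functions
  are Frechet holomorphic. By Cauchy's formula such a derivative is an integral of translates over a
  circle, so that this is another instance of differentiation under the integral sign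
  (\<open>holomorphic_several_dirderiv\<close>).

  The second fact is that a bp-continuous functional \<open>\<phi>\<close> is a limit, in the norm of the dual of
  \<open>H\<^sup>\<infinity>(U)\<close>, of finite linear combinations \<open>\<Sum>\<^sub>z c\<^sub>z \<delta>\<^sub>z\<close> of point evaluations
  (\<open>bp_continuous_approx\<close>). Indeed, by equicontinuity and bp-continuity there are finitely many points such that
  \<open>\<bar>\<phi> g\<bar> \<le> \<epsilon> \<parallel>g\<parallel>\<close> for all \<open>g\<close> that vanish there. The Hahn-Banach argument for a subspace of
  finite codimension then moves \<open>\<phi>\<close> by a combination of the corresponding evaluations so that the bound
  holds on all of \<open>H\<^sup>\<infinity>(U)\<close>.

  Consequently \<open>t \<mapsto> \<phi>(f\<^sub>t)\<close> is the limit of the functions \<open>\<Sum>\<^sub>z c\<^sub>z F(z)\<close>, at every point and in the norm of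
  \<open>L\<^sub>\<infinity>\<close>. Its measurability, its membership in the weak closure of the span of \<open>F(U)\<close>, and the exchange
  of \<open>\<phi>\<close> with the integral all follow from this, being obvious for the approximating functions.
\<close>

section \<open>Directional derivatives and Cauchy estimates\<close>

lemma norm_vector_scalar_mult: "norm (c *s v) = cmod c * norm v" for v :: "complex ^ 'd"
proof -
  have "(\<Sum>i\<in>UNIV. (cmod c * cmod (v $ i))\<^sup>2) = (cmod c)\<^sup>2 * (\<Sum>i\<in>UNIV. (cmod (v $ i))\<^sup>2)"
    by (simp add: power_mult_distrib sum_distrib_left)
  then show ?thesis
    by (simp add: norm_vec_def L2_set_def norm_mult real_sqrt_mult)
qed

lemma bounded_linear_vector_scalar_mult: "bounded_linear (\<lambda>c. c *s v)" for v :: "complex ^ 'd"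
proof (rule bounded_linear_intro)
  show "(r *\<^sub>R x) *s v = r *\<^sub>R (x *s v)" for r x
    by (simp add: vec_eq_iff)
qed (auto simp: vector_sadd_rdistrib norm_vector_scalar_mult)

text \<open>
  The complex derivative at \<open>z\<close> in direction \<open>h\<close>, computed on the complex line through \<open>z\<close>. Working with
  all directions at once, instead of the coordinate directions only, makes the Frechet derivative
  and the partial derivatives two instances of one function, so that one set of estimates serves both.
\<close>
definition dirderiv :: "(complex ^ 'd \<Rightarrow> complex) \<Rightarrow> complex ^ 'd \<Rightarrow> complex ^ 'd \<Rightarrow> complex" where
  "dirderiv g z h = deriv (\<lambda>w. g (z + w *s h)) 0"

lemma vector_scalar_mult_axis: "w *s axis j (1 :: complex) = axis j w"
  by (simp add: vec_eq_iff axis_def)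

lemma partial_deriv_eq_dirderiv: "partial_deriv j g z = dirderiv g z (axis j 1)"
  by (simp add: partial_deriv_def dirderiv_def vector_scalar_mult_axis)

text \<open>
  Restriction to a complex line turns a \<open>\<complex>\<close>-linear Frechet derivative into an ordinary complex
  derivative; this gives access to the Cauchy theory of one variable.
\<close>
lemma slice_has_field_derivative:
  fixes g :: "complex ^ 'd \<Rightarrow> complex"
  assumes g: "(g has_derivative A) (at (z + w *s h))" and A: "\<And>c v. A (c *s v) = c * A v"
  shows "((\<lambda>w. g (z + w *s h)) has_field_derivative A h) (at w)"
proof -
  have "((\<lambda>w. z + w *s h) has_derivative (\<lambda>w. w *s h)) (at w)"
    using has_derivative_add[OF has_derivative_const
      bounded_linear_imp_has_derivative[OF bounded_linear_vector_scalar_mult]] by simp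
  then have "((\<lambda>w. g (z + w *s h)) has_derivative (\<lambda>w. A (w *s h))) (at w)"
    using g by (rule has_derivative_compose)
  moreover have "(\<lambda>w. A (w *s h)) = (*) (A h)"
    by (auto simp: A)
  ultimately show ?thesis
    by (simp add: has_field_derivative_def)
qed

lemma holomorphic_several_has_derivative:
  assumes "holomorphic_several U g" "z \<in> U"
  shows "(g has_derivative dirderiv g z) (at z)"
    and "dirderiv g z (c *s v) = c * dirderiv g z v"
proof -
  obtain A where A: "(g has_derivative A) (at z)" "\<And>c v. A (c *s v) = c * A v"
    using assms unfolding holomorphic_several_def by blast
  have "dirderiv g z h = A h" for h
    using slice_has_field_derivative[of g A z 0 h] A by (simp add: dirderiv_def DERIV_imp_deriv)
  then have "dirderiv g z = A" by auto
  with A show "(g has_derivative dirderiv g z) (at z)" 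
    "dirderiv g z (c *s v) = c * dirderiv g z v" by auto
qed

lemma holomorphic_several_continuous: 
  "holomorphic_several U g \<Longrightarrow> z \<in> U \<Longrightarrow> isCont g z"
  using holomorphic_several_has_derivative(1) has_derivative_continuous by blast

lemma holomorphic_several_subset:
  "holomorphic_several U g \<Longrightarrow> V \<subseteq> U \<Longrightarrow> holomorphic_several V g"
  by (auto simp: holomorphic_several_def)

lemma slice_in_ball:
  assumes "cmod w * norm h < r"
  shows "z + w *s h \<in> ball z r"
  using assms by (simp add: dist_norm norm_vector_scalar_mult)

lemma slice_holomorphic:
  assumes g: "holomorphic_several (ball z r) g" and R: "R * norm h \<le> r" and "0 < r"
  shows "(\<lambda>w. g (z + w *s h)) holomorphic_on ball 0 R"
proof (rule holomorphic_onI)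
  fix w :: complex assume "w \<in> ball 0 R"
  then have "cmod w * norm h < R * norm h" if "h \<noteq> 0" using that by simp
  with R \<open>0 < r\<close> have "cmod w * norm h < r" by (cases "h = 0") (simp, linarith)
  then have "z + w *s h \<in> ball z r" by (rule slice_in_ball)
  then show "(\<lambda>w. g (z + w *s h)) field_differentiable at w within ball 0 R"
    using slice_has_field_derivative holomorphic_several_has_derivative[OF g]
      field_differentiable_at_within unfolding field_differentiable_def by blast
qed

text \<open>
  Cauchy's estimate on the line \<open>z + w h\<close>, which stays in the ball for \<open>\<bar>w\<bar> < r / \<parallel>h\<parallel>\<close>. The circle of half
  that radius is used, so that no limit of radii is needed; this costs the factor 2.
\<close>
lemma dirderiv_bound:
  assumes g: "holomorphic_several (ball z r) g" and C: "\<And>y. y \<in> ball z r \<Longrightarrow> cmod (g y) \<le> C"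
    and r: "0 < r"
  shows "cmod (dirderiv g z h) \<le> 2 * C / r * norm h"
proof (cases "h = 0")
  case True
  then show ?thesis by (simp add: dirderiv_def)
next
  case False
  define R where "R = r / norm h"
  let ?u = "\<lambda>w. g (z + w *s h)"
  have R: "R > 0" "R * norm h = r" using False r by (auto simp: R_def)
  have hol: "?u holomorphic_on ball 0 R"
    by (rule slice_holomorphic[OF g]) (use R r in auto)
  have sub: "cball 0 (R/2) \<subseteq> ball (0::complex) R" using R by auto
  have "cmod ((deriv ^^ 1) ?u 0) \<le> fact 1 * C / (R/2) ^ 1"
  proof (rule Cauchy_inequality)
    show "?u holomorphic_on ball 0 (R/2)" using hol sub by (meson ball_subset_cball holomorphic_on_subset)
    show "continuous_on (cball 0 (R/2)) ?u" using hol sub 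
      by (meson holomorphic_on_imp_continuous_on continuous_on_subset)
    fix w :: complex assume "cmod (0 - w) = R / 2"
    then have "cmod w * norm h = r / 2" using R(2) by auto
    then have "cmod w * norm h < r" using r by simp
    then show "cmod (?u w) \<le> C" by (intro C slice_in_ball)
  qed (use R in auto)
  then show ?thesis using False by (simp add: dirderiv_def R_def divide_simps mult_ac)
qed

text \<open>
  The first order Taylor remainder at \<open>w = 1\<close> on the line \<open>z + w h\<close>, with the second derivative controlled
  by Cauchy's estimate. What matters is that the bound depends on \<open>g\<close> only through \<open>C\<close>: for a family
  \<open>f\<^sub>t\<close> bounded by one \<open>C\<close> the differentiability is uniform in \<open>t\<close>, hence survives both
  the passage to \<open>L\<^sub>\<infinity>\<close> and integration over \<open>t\<close>.
\<close>
lemma holomorphic_remainder_bound: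
  assumes g: "holomorphic_several (ball z r) g" and C: "\<And>y. y \<in> ball z r \<Longrightarrow> cmod (g y) \<le> C"
    and h: "norm h < r / 2"
  shows "cmod (g (z + h) - g z - dirderiv g z h) \<le> 8 * C / r\<^sup>2 * (norm h)\<^sup>2"
proof (cases "h = 0")
  case True
  then show ?thesis by (simp add: dirderiv_def)
next
  case False
  \<comment> \<open>The radius up to which the line stays in the ball; it exceeds 2, so discs of radius \<open>R / 2\<close> around points of the closed unit disc fit.\<close>
  define R where "R = r / norm h"
  let ?u = "\<lambda>w. g (z + w *s h)"
  have r: "r > 0" using h norm_ge_zero[of h] by linarith
  have R: "R > 2" "R * norm h = r" using False r h by (auto simp: R_def field_simps)
  have hol: "?u holomorphic_on ball 0 R"
    by (rule slice_holomorphic[OF g]) (use R r in auto)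
  have sub: "cball w (R/2) \<subseteq> ball 0 R" if "w \<in> cball 0 1" for w :: complex
  proof
    fix x assume "x \<in> cball w (R/2)"
    then have "cmod x \<le> cmod w + R/2" 
      by (metis add.commute diff_add_cancel dist_commute dist_norm mem_cball norm_triangle_mono order_refl)
    then show "x \<in> ball 0 R" using that R by auto
  qed
  have uC: "cmod (?u w) \<le> C" if "w \<in> ball 0 R" for w
  proof (intro C slice_in_ball)
    have "cmod w * norm h < R * norm h" using that False by simp
    then show "cmod w * norm h < r" using R by simp
  qed
  have u2: "cmod ((deriv ^^ 2) ?u w) \<le> 8 * C / R\<^sup>2" if w: "w \<in> cball 0 1" for w
  proof -
    have "cmod ((deriv ^^ 2) ?u w) \<le> fact 2 * C / (R/2) ^ 2"
    proof (rule Cauchy_inequality)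
      show "?u holomorphic_on ball w (R/2)"
        using hol sub[OF w] by (meson ball_subset_cball holomorphic_on_subset)
      show "continuous_on (cball w (R/2)) ?u" using hol sub[OF w]
        by (meson holomorphic_on_imp_continuous_on continuous_on_subset)
      fix x :: complex assume "cmod (w - x) = R / 2"
      then have "x \<in> cball w (R/2)" by (simp add: dist_norm)
      then show "cmod (?u x) \<le> C" using uC sub[OF w] by blast
    qed (use R in auto)
    then show ?thesis by (simp add: power_divide mult_ac)
  qed
  have "cmod ((deriv ^^ 0) ?u 1 - (\<Sum>i\<le>1. (deriv ^^ i) ?u 0 * (1 - 0) ^ i / fact i))
     \<le> 8 * C / R\<^sup>2 * cmod (1 - 0) ^ (Suc 1) / fact 1"
  proof (rule complex_Taylor[where f = "\<lambda>i. (deriv ^^ i) ?u"])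
    show "convex (cball 0 1 :: complex set)" by simp
    fix i and x :: complex assume x: "x \<in> cball 0 1"
    have "x \<in> ball 0 R" using x R by auto
    then have "((deriv ^^ i) ?u has_field_derivative (deriv ((deriv ^^ i) ?u)) x) (at x)"
      using hol by (intro holomorphic_derivI[where S="ball 0 R"] holomorphic_higher_deriv) auto
    then show "((deriv ^^ i) ?u has_field_derivative (deriv ^^ (Suc i)) ?u x) (at x within cball 0 1)"
      by (simp add: has_field_derivative_at_within)
  next
    fix x :: complex assume "x \<in> cball 0 1"
    then show "cmod ((deriv ^^ Suc 1) ?u x) \<le> 8 * C / R\<^sup>2"
      using u2[of x] by (simp add: numeral_2_eq_2)
  qed auto
  then show ?thesis using False 
    by (simp add: dirderiv_def R_def power_divide diff_diff_eq)
qed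

lemma holomorphic_lipschitz_bound:
  assumes g: "holomorphic_several (ball z r) g" and C: "\<And>y. y \<in> ball z r \<Longrightarrow> cmod (g y) \<le> C"
    and h: "norm h < r / 2"
  shows "cmod (g (z + h) - g z) \<le> 6 * C / r * norm h"
proof -
  have r: "r > 0" using h norm_ge_zero[of h] by linarith
  have C0: "C \<ge> 0" using C[of z] r order_trans[OF norm_ge_zero] by force
  have "cmod (g (z + h) - g z) \<le> cmod (g (z + h) - g z - dirderiv g z h) + cmod (dirderiv g z h)"
    by norm
  also have "\<dots> \<le> 8 * C / r\<^sup>2 * (norm h)\<^sup>2 + 2 * C / r * norm h"
    by (intro add_mono holomorphic_remainder_bound dirderiv_bound assms r)
  also have "8 * C / r\<^sup>2 * (norm h)\<^sup>2 = 8 * C / r * norm h * (norm h / r)"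
    by (simp add: power2_eq_square)
  also have "\<dots> \<le> 8 * C / r * norm h * (1 / 2)"
    using h r C0 by (intro mult_left_mono) (auto simp: field_simps)
  finally show ?thesis by (simp add: field_simps)
qed

lemma has_derivative_of_quadratic_remainder:
  fixes u :: "'n::real_normed_vector \<Rightarrow> 'm::real_normed_vector"
  assumes "bounded_linear A" "\<delta> > 0"
    and "\<And>h. norm h < \<delta> \<Longrightarrow> norm (u (z + h) - u z - A h) \<le> K * (norm h)\<^sup>2"
  shows "(u has_derivative A) (at z)"
proof -
  have "((\<lambda>h. norm (u (z + h) - u z - A h) / norm h) \<longlongrightarrow> 0) (at 0)"
  proof (rule Lim_null_comparison)
    show "((\<lambda>h::'n. K * norm h) \<longlongrightarrow> 0) (at 0)"
      by (auto intro!: tendsto_eq_intros)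
    have "eventually (\<lambda>h::'n. norm h < \<delta> \<and> h \<noteq> 0) (at 0)"
      unfolding eventually_at using \<open>\<delta> > 0\<close> by (auto simp: dist_norm)
    then show "\<forall>\<^sub>F h in at 0. norm (norm (u (z + h) - u z - A h) / norm h) \<le> K * norm h"
      by eventually_elim (use assms(3) in \<open>auto simp: divide_simps power2_eq_square mult_ac\<close>)
  qed
  then show ?thesis using assms(1) by (simp add: has_derivative_at)
qed

lemma dirderiv_unique:
  assumes "(g has_derivative A) (at z)" "\<And>c v. A (c *s v) = c * A v"
  shows "dirderiv g z = A"
  using slice_has_field_derivative[of g A z 0] assms by (auto simp: dirderiv_def DERIV_imp_deriv)

lemma dirderiv_add:
  assumes "holomorphic_several U g" "z \<in> U"
  shows "dirderiv g z (v + w) = dirderiv g z v + dirderiv g z w"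
  using holomorphic_several_has_derivative(1)[OF assms] has_derivative_linear linear_add by blast

lemma has_field_derivative_dirderiv:
  assumes "holomorphic_several U g" "z \<in> U"
  shows "((\<lambda>w. g (z + w *s h)) has_field_derivative dirderiv g z h) (at 0)"
  using slice_has_field_derivative[of g "dirderiv g z" z 0 h] holomorphic_several_has_derivative[OF assms]
  by simp

section \<open>Families of holomorphic functions and integration over the parameter\<close>

text \<open>
  Uniform boundedness is required near each point only: unlike boundedness on all of \<open>U\<close>, this is
  inherited by derivatives, so the notion can be iterated along a multi-index. The exceptional null set
  may depend on the ball, but not on the point \<open>y\<close> in it.
\<close>
definition holomorphic_family :: 
    "'a measure \<Rightarrow> (complex ^ 'd) set \<Rightarrow> (complex ^ 'd \<Rightarrow> 'a \<Rightarrow> complex) \<Rightarrow> bool" where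
  "holomorphic_family M U f \<longleftrightarrow>
     (\<forall>z\<in>U. f z \<in> borel_measurable M) \<and>
     (\<forall>t\<in>space M. holomorphic_several U (\<lambda>z. f z t)) \<and>
     (\<forall>z\<in>U. \<exists>r>0. \<exists>C. ball z r \<subseteq> U \<and> (AE t in M. \<forall>y\<in>ball z r. cmod (f y t) \<le> C))"

lemma holomorphic_familyD:
  assumes "holomorphic_family M U f"
  shows "z \<in> U \<Longrightarrow> f z \<in> borel_measurable M" 
    and "t \<in> space M \<Longrightarrow> holomorphic_several U (\<lambda>z. f z t)"
  using assms by (auto simp: holomorphic_family_def)

lemma holomorphic_family_bound:
  assumes "holomorphic_family M U f" "z \<in> U"
  obtains r C where "0 < r" "0 \<le> C" "ball z r \<subseteq> U" 
    "AE t in M. holomorphic_several (ball z r) (\<lambda>z. f z t) \<and> (\<forall>y\<in>ball z r. cmod (f y t) \<le> C)"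
proof -
  obtain r C where *: "0 < r" "ball z r \<subseteq> U" "AE t in M. \<forall>y\<in>ball z r. cmod (f y t) \<le> C"
    using assms unfolding holomorphic_family_def by blast
  have "AE t in M. holomorphic_several (ball z r) (\<lambda>z. f z t) \<and> (\<forall>y\<in>ball z r. cmod (f y t) \<le> \<bar>C\<bar>)"
    using *(3) AE_space
  proof eventually_elim
    case (elim t)
    have "holomorphic_several (ball z r) (\<lambda>z. f z t)"
      by (rule holomorphic_several_subset[OF holomorphic_familyD(2)[OF assms(1) elim(2)] *(2)])
    then show ?case using elim(1) order_trans[OF _ abs_ge_self] by blast
  qed
  then show ?thesis by (rule that[OF *(1) abs_ge_zero *(2)])
qed

lemma holomorphic_family_open: 
  assumes "holomorphic_family M U f" shows "open U"
  using assms unfolding open_contains_ball holomorphic_family_def by blast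

lemma dirderiv_measurable:
  assumes f: "holomorphic_family M U f" and z: "z \<in> U"
  shows "(\<lambda>t. dirderiv (\<lambda>y. f y t) z h) \<in> borel_measurable M"
proof -
  obtain r where r: "r > 0" "ball z r \<subseteq> U"
    using holomorphic_family_open[OF f] z by (meson open_contains_ball)
  \<comment> \<open>Measurability is that of a limit of difference quotients along a sequence that keeps \<open>z + x n h\<close> inside \<open>U\<close>.\<close>
  define x :: "nat \<Rightarrow> complex" where "x n = of_real (r / (norm h + 1) / real (Suc n))" for n
  have x0: "x n \<noteq> 0" for n
    using r add_nonneg_pos[OF norm_ge_zero[of h] zero_less_one] by (simp add: x_def del: of_nat_Suc of_real_divide)
  have xr: "cmod (x n) * norm h < r" for n
  proof -
    have "0 \<le> r / (norm h + 1)" using r by simp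
    then have "r / (norm h + 1) / real (Suc n) \<le> r / (norm h + 1) / 1"
      by (intro divide_left_mono) auto
    then have "r / (norm h + 1) / real (Suc n) * norm h \<le> r / (norm h + 1) * norm h"
      by (intro mult_right_mono) auto
    also have "\<dots> < r" using r by (auto simp: field_simps add_pos_nonneg)
    finally show ?thesis using r by (simp add: x_def norm_divide norm_mult del: of_nat_Suc)
  qed
  have "x \<longlonglongrightarrow> of_real 0"
    unfolding x_def by (intro tendsto_of_real LIMSEQ_Suc lim_const_over_n)
  then have lim: "filterlim x (at 0) sequentially"
    using x0 by (auto simp: filterlim_at)
  show ?thesis
  proof (rule borel_measurable_LIMSEQ_metric)
    fix n 
    have "z + x n *s h \<in> U" using slice_in_ball[OF xr] r by blast
    then show "(\<lambda>t. (f (z + x n *s h) t - f z t) / x n) \<in> borel_measurable M"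
      using holomorphic_familyD(1)[OF f] z by measurable
  next
    fix t assume t: "t \<in> space M"
    have "((\<lambda>w. (f (z + w *s h) t - f z t) / w) \<longlongrightarrow> dirderiv (\<lambda>y. f y t) z h) (at 0)"
      using has_field_derivative_dirderiv[OF holomorphic_familyD(2)[OF f t] z, of h] 
      by (simp add: DERIV_def)
    then show "(\<lambda>n. (f (z + x n *s h) t - f z t) / x n) \<longlonglongrightarrow> dirderiv (\<lambda>y. f y t) z h"
      by (rule filterlim_compose[OF _ lim])
  qed
qed

lemma integrable_bounded_mult:
  fixes u g :: "'a \<Rightarrow> complex"
  assumes u: "u \<in> borel_measurable M" and C: "AE t in M. cmod (u t) \<le> C" and g: "integrable M g"
  shows "integrable M (\<lambda>t. u t * g t)"
    and "cmod (\<integral>t. u t * g t \<partial>M) \<le> C * (\<integral>t. cmod (g t) \<partial>M)"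
proof -
  have ae: "AE t in M. cmod (u t * g t) \<le> C * cmod (g t)"
    using C by eventually_elim (auto simp: norm_mult intro: mult_right_mono)
  have ig: "integrable M (\<lambda>t. C * cmod (g t))" using g by simp
  show i: "integrable M (\<lambda>t. u t * g t)"
  proof (rule Bochner_Integration.integrable_bound[OF ig])
    show "(\<lambda>t. u t * g t) \<in> borel_measurable M" using u g by measurable
    show "AE t in M. norm (u t * g t) \<le> norm (C * cmod (g t))"
      using ae by eventually_elim simp
  qed
  have "cmod (\<integral>t. u t * g t \<partial>M) \<le> (\<integral>t. cmod (u t * g t) \<partial>M)" by (rule integral_norm_bound)
  also have "\<dots> \<le> (\<integral>t. C * cmod (g t) \<partial>M)"
    by (rule integral_mono_AE[OF integrable_norm[OF i] ig ae])
  finally show "cmod (\<integral>t. u t * g t \<partial>M) \<le> C * (\<integral>t. cmod (g t) \<partial>M)" by simp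
qed

lemma dirderiv_AE_bound:
  assumes f: "holomorphic_family M U f" and z: "z \<in> U"
  shows "\<exists>B\<ge>0. \<forall>h. AE t in M. cmod (dirderiv (\<lambda>y. f y t) z h) \<le> B * norm h"
proof -
  obtain r C where r: "0 < r" "0 \<le> C" "ball z r \<subseteq> U" 
    and ae: "AE t in M. holomorphic_several (ball z r) (\<lambda>z. f z t) \<and> (\<forall>y\<in>ball z r. cmod (f y t) \<le> C)"
    by (rule holomorphic_family_bound[OF f z])
  have "AE t in M. cmod (dirderiv (\<lambda>y. f y t) z h) \<le> 2 * C / r * norm h" for h
    using ae
  proof eventually_elim
    case (elim t)
    then show ?case using r(1) by (intro dirderiv_bound[where g = "\<lambda>y. f y t"]) auto
  qed
  then show ?thesis using r by (intro exI[of _ "2 * C / r"]) auto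
qed

lemma remainder_AE_bound:
  assumes f: "holomorphic_family M U f" and z: "z \<in> U"
  shows "\<exists>\<delta>>0. \<exists>K\<ge>0. ball z \<delta> \<subseteq> U \<and> (\<forall>h. norm h < \<delta> \<longrightarrow>
    (AE t in M. cmod (f (z + h) t - f z t - dirderiv (\<lambda>y. f y t) z h) \<le> K * (norm h)\<^sup>2))"
proof -
  obtain r C where r: "0 < r" "0 \<le> C" "ball z r \<subseteq> U" 
    and ae: "AE t in M. holomorphic_several (ball z r) (\<lambda>z. f z t) \<and> (\<forall>y\<in>ball z r. cmod (f y t) \<le> C)"
    by (rule holomorphic_family_bound[OF f z])
  have "AE t in M. cmod (f (z + h) t - f z t - dirderiv (\<lambda>y. f y t) z h) \<le> 8 * C / r\<^sup>2 * (norm h)\<^sup>2" 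
    if "norm h < r / 2" for h
    using ae
  proof eventually_elim
    case (elim t)
    then show ?case using that by (intro holomorphic_remainder_bound[where g = "\<lambda>y. f y t"]) auto
  qed
  moreover have "ball z (r/2) \<subseteq> U" using r by (auto simp: subset_iff)
  ultimately show ?thesis using r
    by (intro exI[of _ "r/2"] conjI exI[of _ "8 * C / r\<^sup>2"]) auto
qed

lemma integrable_holomorphic_family:
  assumes f: "holomorphic_family M U f" and z: "z \<in> U" and g: "integrable M g"
  shows "integrable M (\<lambda>t. f z t * g t)" "integrable M (\<lambda>t. dirderiv (\<lambda>y. f y t) z h * g t)"
proof -
  obtain r C where r: "0 < r"
    and ae: "AE t in M. holomorphic_several (ball z r) (\<lambda>z. f z t) \<and> (\<forall>y\<in>ball z r. cmod (f y t) \<le> C)"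
    by (rule holomorphic_family_bound[OF f z])
  have "AE t in M. cmod (f z t) \<le> C" using ae by eventually_elim (use r in auto)
  then show "integrable M (\<lambda>t. f z t * g t)" 
    using integrable_bounded_mult(1)[OF holomorphic_familyD(1)[OF f z] _ g] by blast
  obtain B where "0 \<le> B" "\<And>h. AE t in M. cmod (dirderiv (\<lambda>y. f y t) z h) \<le> B * norm h"
    using dirderiv_AE_bound[OF f z] by blast
  then show "integrable M (\<lambda>t. dirderiv (\<lambda>y. f y t) z h * g t)"
    using integrable_bounded_mult(1)[OF dirderiv_measurable[OF f z] _ g] by blast
qed

text \<open>
  The remainder bound is uniform in \<open>t\<close>, so integrating it against \<open>\<bar>g\<bar>\<close> leaves a remainder that is
  still quadratic in \<open>h\<close>; the derivative may be taken under the integral sign.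
\<close>
lemma has_derivative_integral_family:
  assumes f: "holomorphic_family M U f" and z: "z \<in> U" and g: "integrable M g"
  defines "A \<equiv> \<lambda>h. \<integral>t. dirderiv (\<lambda>y. f y t) z h * g t \<partial>M"
  shows "((\<lambda>y. \<integral>t. f y t * g t \<partial>M) has_derivative A) (at z)" "A (c *s v) = c * A v"
proof -
  note int = integrable_holomorphic_family[OF f _ g]
  have hol: "holomorphic_several U (\<lambda>z. f z t)" if "t \<in> space M" for t
    using holomorphic_familyD(2)[OF f that] .
  have scale: "A (c *s v) = c * A v" for c v
  proof -
    have "A (c *s v) = (\<integral>t. c * (dirderiv (\<lambda>y. f y t) z v * g t) \<partial>M)"
      unfolding A_def using holomorphic_several_has_derivative(2)[OF hol z] 
      by (intro Bochner_Integration.integral_cong) auto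
    then show ?thesis by (simp add: A_def)
  qed
  have add: "A (v + w) = A v + A w" for v w
  proof -
    have "A (v + w) = (\<integral>t. dirderiv (\<lambda>y. f y t) z v * g t + dirderiv (\<lambda>y. f y t) z w * g t \<partial>M)"
      unfolding A_def using dirderiv_add[OF hol z] 
      by (intro Bochner_Integration.integral_cong) (auto simp: algebra_simps)
    then show ?thesis by (simp add: A_def int z)
  qed
  obtain B where "0 \<le> B" and B: "\<And>h. AE t in M. cmod (dirderiv (\<lambda>y. f y t) z h) \<le> B * norm h"
    using dirderiv_AE_bound[OF f z] by blast
  have lin: "bounded_linear A"
  proof (rule bounded_linear_intro[where K = "B * (\<integral>t. cmod (g t) \<partial>M)"])
    show "A (x + y) = A x + A y" for x y by (rule add)
    have "r *\<^sub>R x = complex_of_real r *s x" for r and x :: "complex ^ 'b"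
      unfolding vec_eq_iff vector_scaleR_component vector_smult_component by (simp add: scaleR_conv_of_real)
    then show "A (r *\<^sub>R x) = r *\<^sub>R A x" for r x
      by (simp add: scale scaleR_conv_of_real)
    show "norm (A x) \<le> norm x * (B * (\<integral>t. cmod (g t) \<partial>M))" for x
      using integrable_bounded_mult(2)[OF dirderiv_measurable[OF f z] B g] by (simp add: A_def mult_ac)
  qed
  obtain \<delta> K where \<delta>: "0 < \<delta>" "0 \<le> K" "ball z \<delta> \<subseteq> U"
    and K: "\<And>h. norm h < \<delta> \<Longrightarrow> AE t in M. cmod (f (z + h) t - f z t - dirderiv (\<lambda>y. f y t) z h) \<le> K * (norm h)\<^sup>2"
    using remainder_AE_bound[OF f z] by blast
  show "((\<lambda>y. \<integral>t. f y t * g t \<partial>M) has_derivative A) (at z)"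
  proof (rule has_derivative_of_quadratic_remainder[OF lin \<delta>(1)])
    fix h :: "complex ^ 'b" assume h: "norm h < \<delta>"
    then have zh: "z + h \<in> U" using \<delta>(3) by (auto simp: dist_norm subset_iff)
    have "(\<integral>t. f (z + h) t * g t \<partial>M) - (\<integral>t. f z t * g t \<partial>M) - A h =
       (\<integral>t. (f (z + h) t - f z t - dirderiv (\<lambda>y. f y t) z h) * g t \<partial>M)"
      unfolding A_def left_diff_distrib by (simp add: int z zh)
    also have "cmod \<dots> \<le> K * (norm h)\<^sup>2 * (\<integral>t. cmod (g t) \<partial>M)"
    proof (rule integrable_bounded_mult(2)[OF _ K[OF h] g])
      show "(\<lambda>t. f (z + h) t - f z t - dirderiv (\<lambda>y. f y t) z h) \<in> borel_measurable M"
        by (intro borel_measurable_diff holomorphic_familyD(1)[OF f] dirderiv_measurable[OF f] z zh)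
    qed
    finally show "cmod ((\<integral>t. f (z + h) t * g t \<partial>M) - (\<integral>t. f z t * g t \<partial>M) - A h)
        \<le> K * (\<integral>t. cmod (g t) \<partial>M) * (norm h)\<^sup>2" by (simp add: mult_ac)
  qed
  show "A (c *s v) = c * A v" by (rule scale)
qed

lemma holomorphic_several_integral_family:
  assumes f: "holomorphic_family M U f" and g: "integrable M g"
  shows "holomorphic_several U (\<lambda>y. \<integral>t. f y t * g t \<partial>M)"
  unfolding holomorphic_several_def
  using has_derivative_integral_family[OF f _ g] by blast

lemma dirderiv_integral_family:
  assumes f: "holomorphic_family M U f" and z: "z \<in> U" and g: "integrable M g"
  shows "dirderiv (\<lambda>y. \<integral>t. f y t * g t \<partial>M) z h = (\<integral>t. dirderiv (\<lambda>y. f y t) z h * g t \<partial>M)"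
  by (subst dirderiv_unique[OF has_derivative_integral_family[OF f z g]]) simp

text \<open>
  Cauchy's formula for the derivative, written as a Lebesgue integral over the parameter of the circle.
  In this form the derivative is the integral of a holomorphic family, with \<open>z\<close> as its variable
  and the angle as its parameter.
\<close>
lemma dirderiv_circle_integral:
  assumes g: "holomorphic_several (ball z r) g" and \<rho>: "0 < \<rho>" "\<rho> * norm h < r"
  shows "dirderiv g z h = 
    (\<integral>\<theta>. g (z + circlepath 0 \<rho> \<theta> *s h) * (indicator {0..1} \<theta> *\<^sub>R (1 / circlepath 0 \<rho> \<theta>)) \<partial>lborel)"
proof -
  let ?c = "circlepath 0 \<rho>" let ?u = "\<lambda>w. g (z + w *s h)"
  have c0: "?c \<theta> \<noteq> 0" for \<theta> using \<rho> by (simp add: circlepath)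
  have r: "0 < r" using \<rho> by (meson mult_nonneg_nonneg norm_ge_zero order_le_less_trans less_imp_le)
  have hol: "isCont ?u w" "?u field_differentiable (at w)" if "cmod w \<le> \<rho>" for w
  proof -
    have "cmod w * norm h \<le> \<rho> * norm h" using that by (intro mult_right_mono) auto
    then have "z + w *s h \<in> ball z r" using \<rho>(2) by (intro slice_in_ball) auto
    then have "(?u has_field_derivative dirderiv g (z + w *s h) h) (at w)"
      using holomorphic_several_has_derivative[OF g] by (intro slice_has_field_derivative)
    then show "isCont ?u w" "?u field_differentiable (at w)" 
      by (auto simp: DERIV_isCont field_differentiable_def)
  qed
  have cont: "continuous_on (cball 0 \<rho>) ?u"
    by (intro continuous_at_imp_continuous_on ballI hol(1)) simp
  have hol': "?u holomorphic_on ball 0 \<rho>"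
    by (rule holomorphic_onI, rule field_differentiable_at_within, rule hol(2)) simp
  have "dirderiv g z h = 1 / (2 * of_real pi * \<i>) * contour_integral ?c (\<lambda>w. ?u w / (w - 0)\<^sup>2)"
    unfolding dirderiv_def
    by (rule DERIV_imp_deriv, rule Cauchy_derivative_integral_circlepath(2)[OF cont hol']) (use \<rho> in auto)
  also have "contour_integral ?c (\<lambda>w. ?u w / (w - 0)\<^sup>2) =
     integral {0..1} (\<lambda>\<theta>. ?u (?c \<theta>) / (?c \<theta>)\<^sup>2 * vector_derivative ?c (at \<theta>))"
    by (simp add: contour_integral_integral)
  also have "\<dots> = integral {0..1} (\<lambda>\<theta>. (2 * of_real pi * \<i>) * (?u (?c \<theta>) * (1 / ?c \<theta>)))"
  proof (rule Henstock_Kurzweil_Integration.integral_cong)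
    fix \<theta> :: real assume "\<theta> \<in> {0..1}"
    then have "vector_derivative ?c (at \<theta>) = (2 * of_real pi * \<i>) * ?c \<theta>"
      by (subst vector_derivative_circlepath) (simp add: circlepath)
    then show "?u (?c \<theta>) / (?c \<theta>)\<^sup>2 * vector_derivative ?c (at \<theta>) =
      (2 * of_real pi * \<i>) * (?u (?c \<theta>) * (1 / ?c \<theta>))"
      using c0[of \<theta>] by (simp add: power2_eq_square)
  qed
  also have "1 / (2 * of_real pi * \<i>) * \<dots> = integral {0..1} (\<lambda>\<theta>. ?u (?c \<theta>) * (1 / ?c \<theta>))"
    by (subst integral_mult_right) simp
  also have "\<dots> = set_lebesgue_integral lborel {0..1} (\<lambda>\<theta>. ?u (?c \<theta>) * (1 / ?c \<theta>))"
  proof (rule set_borel_integral_eq_integral(2)[symmetric], rule borel_integrable_atLeastAtMost')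
    have cc: "continuous_on {0..1} ?c" unfolding circlepath by (intro continuous_intros)
    moreover have "continuous_on {0..1} (\<lambda>\<theta>. ?u (?c \<theta>))"
      by (rule continuous_on_compose2[OF cont cc]) (use \<rho> in \<open>auto simp: circlepath norm_mult\<close>)
    ultimately show "continuous_on {0..1} (\<lambda>\<theta>. ?u (?c \<theta>) * (1 / ?c \<theta>))"
      using c0 by (intro continuous_intros) auto
  qed
  finally show ?thesis by (simp add: set_lebesgue_integral_def)
qed

lemma holomorphic_several_translate:
  assumes "holomorphic_several V g" "\<And>z. z \<in> U \<Longrightarrow> z + b \<in> V"
  shows "holomorphic_several U (\<lambda>z. g (z + b))"
  unfolding holomorphic_several_def
proof
  fix z assume "z \<in> U"
  then have "z + b \<in> V" using assms(2) by blast
  note d = holomorphic_several_has_derivative[OF assms(1) this]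
  have "((\<lambda>z. z + b) has_derivative (\<lambda>v. v)) (at z)" by (auto intro!: derivative_eq_intros)
  then have "((\<lambda>z. g (z + b)) has_derivative dirderiv g (z + b)) (at z)"
    by (rule has_derivative_compose[where f = "\<lambda>z. z + b" and g = g and f' = "\<lambda>v. v", OF _ d(1)])
  then show "\<exists>A. ((\<lambda>z. g (z + b)) has_derivative A) (at z) \<and> (\<forall>c v. A (c *s v) = c * A v)"
    using d(2) by blast
qed

text \<open>
  Near each point \<open>z\<^sub>0\<close> the derivatives are circle integrals of translates of \<open>g\<close>, with one circle for all \<open>z\<close>
  close to \<open>z\<^sub>0\<close>, so differentiation under the integral sign applies.
\<close>
lemma holomorphic_several_dirderiv:
  assumes "open U" and g: "holomorphic_several U g"
  shows "holomorphic_several U (\<lambda>z. dirderiv g z h)"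
  unfolding holomorphic_several_def
proof
  fix z0 assume "z0 \<in> U"
  then obtain s where s: "0 < s" "cball z0 s \<subseteq> U" 
    using \<open>open U\<close> by (auto simp: open_contains_cball)
  define r where "r = s / 2"
  define \<rho> where "\<rho> = r / (norm h + 1)"
  have r: "0 < r" "s = r + r" using s by (auto simp: r_def)
  have "norm h < norm h + 1" by simp
  then have \<rho>: "0 < \<rho>" "\<rho> * norm h < r" using r 
    by (simp_all add: \<rho>_def divide_simps add_nonneg_pos)
  let ?c = "circlepath 0 \<rho>"
  define f where "f = (\<lambda>z \<theta>. g (z + ?c \<theta> *s h))"
  \<comment> \<open>Cauchy's kernel \<open>1 / c\<^sup>2\<close> times the velocity \<open>2 \<pi> \<i> c\<close> of the circle \<open>c\<close>, divided by \<open>2 \<pi> \<i>\<close>.\<close>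
  define \<kappa> where "\<kappa> = (\<lambda>\<theta>. indicator {0..1} \<theta> *\<^sub>R (1 / ?c \<theta>))"
  have cn: "cmod (?c \<theta>) = \<rho>" for \<theta> using \<rho> by (simp add: circlepath norm_mult)
  have cc: "continuous_on UNIV ?c" unfolding circlepath by (intro continuous_intros)
  have c0: "?c \<theta> \<noteq> 0" for \<theta> using \<rho> cn[of \<theta>] by auto
  have inb: "z + ?c \<theta> *s h \<in> cball z0 s" if "z \<in> ball z0 r" for z \<theta>
  proof -
    have "norm (?c \<theta> *s h) < r" using \<rho> by (simp add: norm_vector_scalar_mult cn)
    then show ?thesis using that r norm_triangle_ineq4[of "z0 - z" "?c \<theta> *s h"] 
      by (simp add: dist_norm diff_diff_eq)
  qed
  have sub: "ball z0 r \<subseteq> U" using s r by (auto simp: subset_iff)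
  have "continuous_on (cball z0 s) g" 
    using holomorphic_several_continuous[OF g] s by (intro continuous_at_imp_continuous_on) auto
  then have "bounded (g ` cball z0 s)" 
    by (intro compact_imp_bounded compact_continuous_image) auto
  then obtain C where C: "\<And>y. y \<in> cball z0 s \<Longrightarrow> cmod (g y) \<le> C"
    unfolding bounded_iff by (metis imageI)
  have fam: "holomorphic_family lborel (ball z0 r) f"
    unfolding holomorphic_family_def
  proof (intro conjI ballI)
    fix z assume z: "z \<in> ball z0 r"
    have "isCont (\<lambda>\<theta>. g (z + ?c \<theta> *s h)) \<theta>" for \<theta>
    proof (rule isCont_o2[where g=g and f="\<lambda>\<theta>. z + ?c \<theta> *s h"])
      have "isCont ?c \<theta>" using cc by (simp add: continuous_on_eq_continuous_at)
      then have "isCont (\<lambda>\<theta>. ?c \<theta> *s h) \<theta>"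
        using bounded_linear.isCont[OF bounded_linear_vector_scalar_mult] by blast
      then show "isCont (\<lambda>\<theta>. z + ?c \<theta> *s h) \<theta>" by (intro continuous_intros)
      show "isCont g (z + ?c \<theta> *s h)" using inb[OF z] s holomorphic_several_continuous[OF g] by blast
    qed
    then have "f z \<in> borel_measurable borel" unfolding f_def
      by (intro borel_measurable_continuous_onI continuous_at_imp_continuous_on) auto
    then show "f z \<in> borel_measurable lborel" by simp
    obtain e where e: "e > 0" "ball z e \<subseteq> ball z0 r" 
      using z open_ball[of z0 r] unfolding open_contains_ball by blast
    then have "\<forall>y\<in>ball z e. cmod (f y t) \<le> C" for t
      using inb by (auto intro!: C simp: f_def)
    then show "\<exists>e>0. \<exists>C. ball z e \<subseteq> ball z0 r \<and> (AE t in lborel. \<forall>y\<in>ball z e. cmod (f y t) \<le> C)"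
      using e by blast
  next
    fix \<theta> :: real
    show "holomorphic_several (ball z0 r) (\<lambda>z. f z \<theta>)" unfolding f_def
      using inb s by (intro holomorphic_several_translate[OF g]) blast
  qed
  have int: "integrable lborel \<kappa>"
  proof -
    have "continuous_on {0..1} (\<lambda>\<theta>. 1 / ?c \<theta>)"
      using c0 continuous_on_subset[OF cc] by (intro continuous_intros) auto
    from borel_integrable_atLeastAtMost'[OF this] show ?thesis
      by (simp add: set_integrable_def \<kappa>_def)
  qed
  have eq: "dirderiv g z h = (\<integral>\<theta>. f z \<theta> * \<kappa> \<theta> \<partial>lborel)" if z: "z \<in> ball z0 r" for z
  proof -
    have "ball z r \<subseteq> cball z0 s"
    proof
      fix x assume "x \<in> ball z r"
      then show "x \<in> cball z0 s" using z r dist_triangle[of z0 x z] by simp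
    qed
    then have "holomorphic_several (ball z r) g" 
      using s holomorphic_several_subset[OF g] by blast
    from dirderiv_circle_integral[OF this \<rho>] show ?thesis by (simp add: f_def \<kappa>_def)
  qed
  obtain A where A: "((\<lambda>z. \<integral>\<theta>. f z \<theta> * \<kappa> \<theta> \<partial>lborel) has_derivative A) (at z0)" 
     "\<forall>c v. A (c *s v) = c * A v"
    using has_derivative_integral_family[OF fam centre_in_ball[THEN iffD2, OF r(1)] int] by blast
  have "((\<lambda>z. dirderiv g z h) has_derivative A) (at z0)"
    by (rule has_derivative_transform_within_open[OF A(1), of "ball z0 r"]) (use r eq in auto)
  with A(2) show "\<exists>A. ((\<lambda>z. dirderiv g z h) has_derivative A) (at z0) \<and> (\<forall>c v. A (c *s v) = c * A v)"
    by blast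
qed

lemma holomorphic_family_dirderiv:
  assumes f: "holomorphic_family M U f"
  shows "holomorphic_family M U (\<lambda>z t. dirderiv (\<lambda>y. f y t) z h)"
  unfolding holomorphic_family_def
proof (intro conjI ballI)
  show "(\<lambda>t. dirderiv (\<lambda>y. f y t) z h) \<in> borel_measurable M" if "z \<in> U" for z
    by (rule dirderiv_measurable[OF f that])
  show "holomorphic_several U (\<lambda>z. dirderiv (\<lambda>y. f y t) z h)" if "t \<in> space M" for t
    by (rule holomorphic_several_dirderiv[OF holomorphic_family_open[OF f] holomorphic_familyD(2)[OF f that]])
  fix z assume z: "z \<in> U"
  obtain r C where r: "0 < r" "0 \<le> C" "ball z r \<subseteq> U" 
    and ae: "AE t in M. holomorphic_several (ball z r) (\<lambda>z. f z t) \<and> (\<forall>y\<in>ball z r. cmod (f y t) \<le> C)"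
    by (rule holomorphic_family_bound[OF f z])
  have sub: "ball y (r/2) \<subseteq> ball z r" if "y \<in> ball z (r/2)" for y
  proof
    fix x assume "x \<in> ball y (r/2)"
    then show "x \<in> ball z r" using that dist_triangle[of z x y] by simp
  qed
  have "AE t in M. \<forall>y\<in>ball z (r/2). cmod (dirderiv (\<lambda>y. f y t) y h) \<le> 2 * C / (r/2) * norm h"
    using ae
  proof (eventually_elim, intro ballI)
    fix t y assume t: "holomorphic_several (ball z r) (\<lambda>z. f z t) \<and> (\<forall>y\<in>ball z r. cmod (f y t) \<le> C)"
      and y: "y \<in> ball z (r/2)"
    show "cmod (dirderiv (\<lambda>y. f y t) y h) \<le> 2 * C / (r/2) * norm h"
    proof (rule dirderiv_bound)
      show "holomorphic_several (ball y (r/2)) (\<lambda>y. f y t)"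
        using t holomorphic_several_subset[OF _ sub[OF y]] by blast
      show "cmod (f x t) \<le> C" if "x \<in> ball y (r/2)" for x using t sub[OF y] that by blast
    qed (use r in auto)
  qed
  moreover have "0 < r/2" "ball z (r/2) \<subseteq> U" using r sub[of z] by auto
  ultimately show "\<exists>r>0. \<exists>C. ball z r \<subseteq> U \<and> 
    (AE t in M. \<forall>y\<in>ball z r. cmod (dirderiv (\<lambda>y. f y t) y h) \<le> C)" by blast
qed

section \<open>Differentiation in \<open>L\<^sub>\<infinity>\<close>\<close>

lemma Linf_norm_AE: "AE t in M. ennreal (cmod (u t)) \<le> Linf_norm M u"
  unfolding Linf_norm_def by (rule esssup_AE)

lemma Linf_norm_le:
  assumes "u \<in> borel_measurable M" "AE t in M. ennreal (cmod (u t)) \<le> c"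
  shows "Linf_norm M u \<le> c"
  unfolding Linf_norm_def using assms by (intro esssup_I) auto

lemma Linf_norm_le_ennreal:
  assumes "u \<in> borel_measurable M" "AE t in M. cmod (u t) \<le> c"
  shows "Linf_norm M u \<le> ennreal c"
proof (rule Linf_norm_le[OF assms(1)])
  show "AE t in M. ennreal (cmod (u t)) \<le> ennreal c"
    using assms(2) by eventually_elim (rule ennreal_leI)
qed

lemma LinfI:
  assumes "u \<in> borel_measurable M" "AE t in M. cmod (u t) \<le> c"
  shows "u \<in> Linf M"
  using Linf_norm_le_ennreal[OF assms] assms(1) 
  by (auto simp: Linf_def intro: order.strict_trans1)

lemma LinfD: "u \<in> Linf M \<Longrightarrow> u \<in> borel_measurable M"
  by (simp add: Linf_def)

lemma Linf_AE_bound: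
  assumes "u \<in> Linf M"
  shows "\<exists>C\<ge>0. AE t in M. cmod (u t) \<le> C"
proof -
  have fin: "Linf_norm M u < \<infinity>" using assms by (simp add: Linf_def)
  have "AE t in M. cmod (u t) \<le> enn2real (Linf_norm M u)"
    using Linf_norm_AE[of u M]
  proof eventually_elim
    case (elim t)
    with fin show ?case by (metis enn2real_ennreal enn2real_mono infinity_ennreal_def norm_ge_zero)
  qed
  then show ?thesis by (intro exI[of _ "enn2real (Linf_norm M u)"]) auto
qed

text \<open>
  The quadratic remainder bound holds for almost every \<open>t\<close> with one constant, which is exactly
  differentiability with respect to the norm of \<open>L\<^sub>\<infinity>\<close>.
\<close>
lemma has_Linf_derivative_family:
  assumes f: "holomorphic_family M U f" and z: "z \<in> U"
  shows "has_Linf_derivative M f (\<lambda>h t. dirderiv (\<lambda>y. f y t) z h) z"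
  unfolding has_Linf_derivative_def
proof (intro conjI allI)
  note hol = holomorphic_familyD(2)[OF f]
  obtain B where "B \<ge> 0" and B: "\<And>h. AE t in M. cmod (dirderiv (\<lambda>y. f y t) z h) \<le> B * norm h"
    using dirderiv_AE_bound[OF f z] by blast
  note meas = dirderiv_measurable[OF f z]
  show "(\<lambda>t. dirderiv (\<lambda>y. f y t) z v) \<in> Linf M" for v
    by (rule LinfI[OF meas B])
  show "AE t in M. dirderiv (\<lambda>y. f y t) z (v + w) = dirderiv (\<lambda>y. f y t) z v + dirderiv (\<lambda>y. f y t) z w" for v w
    using dirderiv_add[OF hol z] by (intro AE_I2)
  show "AE t in M. dirderiv (\<lambda>y. f y t) z (c *s v) = c * dirderiv (\<lambda>y. f y t) z v" for c v
    using holomorphic_several_has_derivative(2)[OF hol z] by (intro AE_I2)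
  show "\<exists>C::real. \<forall>v. Linf_norm M (\<lambda>t. dirderiv (\<lambda>y. f y t) z v) \<le> ennreal (C * norm v)"
    using Linf_norm_le_ennreal[OF meas B] by blast
  obtain \<delta> K where \<delta>: "0 < \<delta>" "0 \<le> K" "ball z \<delta> \<subseteq> U"
    and K: "\<And>h. norm h < \<delta> \<Longrightarrow> AE t in M. cmod (f (z + h) t - f z t - dirderiv (\<lambda>y. f y t) z h) \<le> K * (norm h)\<^sup>2"
    using remainder_AE_bound[OF f z] by blast
  let ?q = "\<lambda>h. Linf_norm M (\<lambda>t. f (z + h) t - f z t - dirderiv (\<lambda>y. f y t) z h) / ennreal (norm h)"
  show "(?q \<longlongrightarrow> 0) (at 0)"
  proof (rule tendsto_sandwich[where f = "\<lambda>_. 0" and h = "\<lambda>h. ennreal (K * norm h)"])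
    have "eventually (\<lambda>h. norm h < \<delta> \<and> h \<noteq> 0) (at 0)"
      unfolding eventually_at using \<delta>(1) by (auto simp: dist_norm)
    then show "\<forall>\<^sub>F h in at 0. ?q h \<le> ennreal (K * norm h)"
    proof eventually_elim
      case (elim h)
      then have zh: "z + h \<in> U" using \<delta>(3) by (auto simp: dist_norm subset_iff)
      have "Linf_norm M (\<lambda>t. f (z + h) t - f z t - dirderiv (\<lambda>y. f y t) z h) \<le> ennreal (K * (norm h)\<^sup>2)"
        by (intro Linf_norm_le_ennreal K borel_measurable_diff holomorphic_familyD(1)[OF f] meas z zh)
           (use elim in auto)
      then have "?q h \<le> ennreal (K * (norm h)\<^sup>2) / ennreal (norm h)"
        by (rule divide_right_mono_ennreal)
      also have "\<dots> = ennreal (K * norm h)"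
        using elim \<delta>(2) by (subst divide_ennreal) (auto simp: power2_eq_square)
      finally show ?case .
    qed
    have "((\<lambda>h::complex ^ 'b. K * norm h) \<longlongrightarrow> 0) (at 0)" by (auto intro!: tendsto_eq_intros)
    from tendsto_ennrealI[OF this] show "((\<lambda>h::complex ^ 'b. ennreal (K * norm h)) \<longlongrightarrow> 0) (at 0)" by simp
  qed auto
qed

lemma Linf_limit_unique:
  assumes "h1 \<in> borel_measurable M" "h2 \<in> borel_measurable M" "F \<noteq> bot"
    and l1: "((\<lambda>w. Linf_norm M (\<lambda>t. q w t - h1 t)) \<longlongrightarrow> 0) F" 
    and l2: "((\<lambda>w. Linf_norm M (\<lambda>t. q w t - h2 t)) \<longlongrightarrow> 0) F"
  shows "AE t in M. h1 t = h2 t"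
proof -
  let ?s = "\<lambda>w. Linf_norm M (\<lambda>t. q w t - h1 t) + Linf_norm M (\<lambda>t. q w t - h2 t)"
  have le: "Linf_norm M (\<lambda>t. h1 t - h2 t) \<le> ?s w" for w
  proof (rule Linf_norm_le)
    show "AE t in M. ennreal (cmod (h1 t - h2 t)) \<le> ?s w"
      using Linf_norm_AE[of "\<lambda>t. q w t - h1 t" M] Linf_norm_AE[of "\<lambda>t. q w t - h2 t" M]
    proof eventually_elim
      case (elim t)
      have "cmod (h1 t - h2 t) \<le> cmod (q w t - h1 t) + cmod (q w t - h2 t)" by norm
      then have "ennreal (cmod (h1 t - h2 t)) \<le> ennreal (cmod (q w t - h1 t)) + ennreal (cmod (q w t - h2 t))"
        by (simp add: ennreal_leI flip: ennreal_plus)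
      also have "\<dots> \<le> ?s w" by (rule add_mono[OF elim])
      finally show ?case .
    qed
  qed (use assms in measurable)
  have "(?s \<longlongrightarrow> 0 + 0) F" by (rule tendsto_add[OF l1 l2])
  then have "Linf_norm M (\<lambda>t. h1 t - h2 t) \<le> 0 + 0"
    by (rule tendsto_lowerbound) (use le \<open>F \<noteq> bot\<close> in auto)
  then have "Linf_norm M (\<lambda>t. h1 t - h2 t) = 0" by simp
  with Linf_norm_AE[of "\<lambda>t. h1 t - h2 t" M] show ?thesis by simp
qed

lemma norm_axis_complex: "norm (axis j w :: complex ^ 'd) = cmod w"
proof -
  have "(\<Sum>i\<in>UNIV. (cmod ((axis j w :: complex ^ 'd) $ i))\<^sup>2) = (\<Sum>i\<in>UNIV. if i = j then (cmod w)\<^sup>2 else 0)"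
    by (rule sum.cong) (auto simp: axis_def)
  then show ?thesis by (simp add: norm_vec_def L2_set_def)
qed

text \<open>
  The function \<open>F\<close> stands for another choice of representatives of the same \<open>L\<^sub>\<infinity>\<close>-valued function.
  This generality is needed because \<^const>\<open>Linf_partial_deriv\<close> picks its values only up to null sets, so that its
  iterates leave the family of pointwise derivatives after the first step.
\<close>
lemma Linf_partial_deriv_family:
  assumes f: "holomorphic_family M U f" 
    and F: "\<And>y. y \<in> U \<Longrightarrow> F y \<in> Linf M" "\<And>y. y \<in> U \<Longrightarrow> AE t in M. F y t = f y t"
    and z: "z \<in> U"
  shows "Linf_partial_deriv M j F z \<in> Linf M"
    and "AE t in M. Linf_partial_deriv M j F z t = partial_deriv j (\<lambda>y. f y t) z"
proof -
  define h0 where "h0 = (\<lambda>t. partial_deriv j (\<lambda>y. f y t) z)"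
  let ?q = "\<lambda>w t. (F (z + axis j w) t - F z t) / w"
  let ?P = "\<lambda>h. h \<in> Linf M \<and> ((\<lambda>w. Linf_norm M (\<lambda>t. ?q w t - h t)) \<longlongrightarrow> 0) (at 0)"
  note meas = dirderiv_measurable[OF f z]
  obtain B where "B \<ge> 0" and B: "\<And>h. AE t in M. cmod (dirderiv (\<lambda>y. f y t) z h) \<le> B * norm h"
    using dirderiv_AE_bound[OF f z] by blast
  have h0: "h0 \<in> Linf M" unfolding h0_def partial_deriv_eq_dirderiv by (rule LinfI[OF meas B])
  obtain \<delta> K where \<delta>: "0 < \<delta>" "0 \<le> K" "ball z \<delta> \<subseteq> U"
    and K: "\<And>h. norm h < \<delta> \<Longrightarrow> AE t in M. cmod (f (z + h) t - f z t - dirderiv (\<lambda>y. f y t) z h) \<le> K * (norm h)\<^sup>2"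
    using remainder_AE_bound[OF f z] by blast
  have "((\<lambda>w. Linf_norm M (\<lambda>t. ?q w t - h0 t)) \<longlongrightarrow> 0) (at 0)"
  proof (rule tendsto_sandwich[where f = "\<lambda>_. 0" and h = "\<lambda>w. ennreal (K * cmod w)"])
    have "eventually (\<lambda>w. cmod w < \<delta> \<and> w \<noteq> 0) (at 0)"
      unfolding eventually_at using \<delta>(1) by (auto simp: dist_norm)
    then show "\<forall>\<^sub>F w in at 0. Linf_norm M (\<lambda>t. ?q w t - h0 t) \<le> ennreal (K * cmod w)"
    proof eventually_elim
      case (elim w)
      note n = norm_axis_complex[of j w]
      then have zh: "z + axis j w \<in> U" using \<delta>(3) elim by (auto simp: dist_norm subset_iff)
      have "AE t in M. cmod (?q w t - h0 t) \<le> K * cmod w"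
        using K[of "axis j w", unfolded n, OF conjunct1[OF elim]] F(2)[OF zh] F(2)[OF z] AE_space
      proof eventually_elim
        case (elim t)
        have "dirderiv (\<lambda>y. f y t) z (axis j w) = w * h0 t"
          using holomorphic_several_has_derivative(2)[OF holomorphic_familyD(2)[OF f elim(4)] z, of w "axis j 1"]
          by (simp add: h0_def partial_deriv_eq_dirderiv vector_scalar_mult_axis)
        with elim have "cmod (F (z + axis j w) t - F z t - w * h0 t) \<le> K * (cmod w)\<^sup>2" by simp
        moreover have "?q w t - h0 t = (F (z + axis j w) t - F z t - w * h0 t) / w"
          using \<open>cmod w < \<delta> \<and> w \<noteq> 0\<close> by (simp add: field_simps)
        ultimately show ?case 
          using \<open>cmod w < \<delta> \<and> w \<noteq> 0\<close> by (simp add: norm_divide divide_simps power2_eq_square mult_ac)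
      qed
      moreover have "(\<lambda>t. ?q w t - h0 t) \<in> borel_measurable M"
        using LinfD[OF F(1)[OF zh]] LinfD[OF F(1)[OF z]] LinfD[OF h0] by measurable
      ultimately show ?case by (intro Linf_norm_le_ennreal)
    qed
    have "((\<lambda>w. K * cmod w) \<longlongrightarrow> 0) (at 0)" by (auto intro!: tendsto_eq_intros)
    from tendsto_ennrealI[OF this] show "((\<lambda>w. ennreal (K * cmod w)) \<longlongrightarrow> 0) (at 0)" by simp
  qed auto
  with h0 have P0: "?P h0" by blast
  then have P1: "?P (Linf_partial_deriv M j F z)"
    unfolding Linf_partial_deriv_def by (rule someI[where P = ?P])
  then show "Linf_partial_deriv M j F z \<in> Linf M" by blast
  have "AE t in M. Linf_partial_deriv M j F z t = h0 t"
    by (rule Linf_limit_unique[of _ M h0 "at (0::complex)" ?q]) (use P0 P1 in \<open>auto dest: LinfD\<close>)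
  then show "AE t in M. Linf_partial_deriv M j F z t = partial_deriv j (\<lambda>y. f y t) z"
    by (simp add: h0_def)
qed

section \<open>Iterated partial derivatives\<close>

text \<open>
  The three descriptions of the iterated derivative (pointwise, in \<open>L\<^sub>\<infinity>\<close>, and under the integral) are
  compared by finding a relation that one differentiation preserves.
\<close>
lemma iterate_partials_transfer:
  assumes step: "\<And>j F G. R F G \<Longrightarrow> R (P j F) (Q j G)" and "R F G"
  shows "R (iterate_partials P \<alpha> F) (iterate_partials Q \<alpha> G)"
proof -
  have pow: "R ((P j ^^ n) F) ((Q j ^^ n) G)" if "R F G" for j n F G
    using that by (induction n) (auto intro: step)
  have "R (foldr (\<lambda>j. P j ^^ \<alpha> j) js F) (foldr (\<lambda>j. Q j ^^ \<alpha> j) js G)" for js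
    by (induction js) (auto intro: pow assms)
  then show ?thesis by (simp add: iterate_partials_def)
qed

definition family_Dmulti ::
    "('d::{finite,linorder} \<Rightarrow> nat) \<Rightarrow> ((complex, 'd) vec \<Rightarrow> 'a \<Rightarrow> complex) \<Rightarrow> (complex, 'd) vec \<Rightarrow> 'a \<Rightarrow> complex" where
  "family_Dmulti = iterate_partials (\<lambda>j f z t. partial_deriv j (\<lambda>y. f y t) z)"

lemma family_Dmulti_apply: "family_Dmulti \<alpha> f z t = Dmulti \<alpha> (\<lambda>y. f y t) z"
proof -
  have "(\<lambda>z. family_Dmulti \<alpha> f z t) = Dmulti \<alpha> (\<lambda>y. f y t)"
    unfolding family_Dmulti_def Dmulti_def
    by (rule iterate_partials_transfer[where R = "\<lambda>F G. (\<lambda>z. F z t) = G"]) auto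
  then show ?thesis by (rule fun_cong)
qed

lemma holomorphic_family_partial_deriv:
  "holomorphic_family M U f \<Longrightarrow> holomorphic_family M U (\<lambda>z t. partial_deriv j (\<lambda>y. f y t) z)"
  unfolding partial_deriv_eq_dirderiv by (rule holomorphic_family_dirderiv)

lemma holomorphic_family_Dmulti:
  assumes "holomorphic_family M U f"
  shows "holomorphic_family M U (family_Dmulti \<alpha> f)"
  unfolding family_Dmulti_def
  by (rule iterate_partials_transfer[where R = "\<lambda>F G. holomorphic_family M U F", OF holomorphic_family_partial_deriv assms])

lemma Linf_Dmulti_family:
  assumes f: "holomorphic_family M U f" "\<And>z. z \<in> U \<Longrightarrow> f z \<in> Linf M" and a: "a \<in> U"
  shows "AE t in M. Linf_Dmulti M \<alpha> f a t = Dmulti \<alpha> (\<lambda>y. f y t) a"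
proof -
  let ?R = "\<lambda>F f. holomorphic_family M U f \<and> (\<forall>z\<in>U. F z \<in> Linf M \<and> (AE t in M. F z t = f z t))"
  have "?R (Linf_Dmulti M \<alpha> f) (family_Dmulti \<alpha> f)"
    unfolding Linf_Dmulti_def family_Dmulti_def
  proof (rule iterate_partials_transfer[where R = ?R])
    show "?R (Linf_partial_deriv M j F) (\<lambda>z t. partial_deriv j (\<lambda>y. f y t) z)" if "?R F f" for j F f
      using that Linf_partial_deriv_family[of M U f F _ j] holomorphic_family_partial_deriv[of M U f j] by blast
  qed (use f in auto)
  with a show ?thesis by (simp add: family_Dmulti_apply)
qed

lemma dirderiv_cong:
  assumes "open U" "z \<in> U" "\<And>y. y \<in> U \<Longrightarrow> g y = g' y"
  shows "dirderiv g z h = dirderiv g' z h"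
proof -
  obtain r where r: "r > 0" "ball z r \<subseteq> U" using assms open_contains_ball by meson
  have "((\<lambda>w. cmod w * norm h) \<longlongrightarrow> 0) (nhds 0)" 
    by (rule tendsto_eq_intros filterlim_ident)+ auto
  from order_tendstoD(2)[OF this r(1)] have "\<forall>\<^sub>F w in nhds 0. g (z + w *s h) = g' (z + w *s h)"
    by eventually_elim (use slice_in_ball r assms in blast)
  then show ?thesis unfolding dirderiv_def by (intro deriv_cong_ev) auto
qed

lemma Dmulti_integral_family:
  assumes f: "holomorphic_family M U f" and g: "integrable M g" and a: "a \<in> U"
  shows "integrable M (\<lambda>t. Dmulti \<alpha> (\<lambda>y. f y t) a * g t)"
    and "Dmulti \<alpha> (\<lambda>z. \<integral>t. f z t * g t \<partial>M) a = (\<integral>t. Dmulti \<alpha> (\<lambda>y. f y t) a * g t \<partial>M)"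
proof -
  show "integrable M (\<lambda>t. Dmulti \<alpha> (\<lambda>y. f y t) a * g t)"
    using integrable_holomorphic_family(1)[OF holomorphic_family_Dmulti[OF f] a g]
    by (simp add: family_Dmulti_apply)
  let ?R = "\<lambda>u f. holomorphic_family M U f \<and> (\<forall>z\<in>U. u z = (\<integral>t. f z t * g t \<partial>M))"
  have "?R (Dmulti \<alpha> (\<lambda>z. \<integral>t. f z t * g t \<partial>M)) (family_Dmulti \<alpha> f)"
    unfolding Dmulti_def family_Dmulti_def
  proof (rule iterate_partials_transfer[where R = ?R])
    show "?R (partial_deriv j u) (\<lambda>z t. partial_deriv j (\<lambda>y. f y t) z)" if R: "?R u f" for j u f
    proof (intro conjI ballI)
      from R have f: "holomorphic_family M U f" by blast
      then show "holomorphic_family M U (\<lambda>z t. partial_deriv j (\<lambda>y. f y t) z)"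
        by (rule holomorphic_family_partial_deriv)
      fix z assume z: "z \<in> U"
      have "partial_deriv j u z = partial_deriv j (\<lambda>z. \<integral>t. f z t * g t \<partial>M) z"
        unfolding partial_deriv_eq_dirderiv
        by (rule dirderiv_cong[OF holomorphic_family_open[OF f] z]) (use R in blast)
      then show "partial_deriv j u z = (\<integral>t. partial_deriv j (\<lambda>y. f y t) z * g t \<partial>M)"
        using dirderiv_integral_family[OF f z g] by (simp add: partial_deriv_eq_dirderiv)
    qed
  qed (use f in auto)
  with a show "Dmulti \<alpha> (\<lambda>z. \<integral>t. f z t * g t \<partial>M) a = (\<integral>t. Dmulti \<alpha> (\<lambda>y. f y t) a * g t \<partial>M)"
    by (simp add: family_Dmulti_apply)
qed

section \<open>Functionals that are small on a subspace of finite codimension\<close>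

text \<open>
  The one-dimensional step of the Hahn-Banach theorem, in dual form. The admissible \<open>c\<close> are those
  between \<open>(\<psi> x - p x) / L x\<close> for \<open>L x > 0\<close> and the same quotients for \<open>L x < 0\<close>. That the former do not
  exceed the latter is the hypothesis on the kernel, applied to the sum of the two vectors after scaling them to
  \<open>L = 1\<close> and \<open>L = -1\<close>.
\<close>
lemma sublinear_real_one_step:
  fixes scale :: "real \<Rightarrow> 'v::ab_semigroup_add \<Rightarrow> 'v" and \<psi> L p :: "'v \<Rightarrow> real"
  assumes X: "\<And>x y. x \<in> X \<Longrightarrow> y \<in> X \<Longrightarrow> x + y \<in> X" "\<And>s x. x \<in> X \<Longrightarrow> scale s x \<in> X"
    and \<psi>: "\<And>x y. x \<in> X \<Longrightarrow> y \<in> X \<Longrightarrow> \<psi> (x + y) = \<psi> x + \<psi> y" "\<And>s x. x \<in> X \<Longrightarrow> \<psi> (scale s x) = s * \<psi> x"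
    and L: "\<And>x y. x \<in> X \<Longrightarrow> y \<in> X \<Longrightarrow> L (x + y) = L x + L y" "\<And>s x. x \<in> X \<Longrightarrow> L (scale s x) = s * L x"
    and p: "\<And>x y. x \<in> X \<Longrightarrow> y \<in> X \<Longrightarrow> p (x + y) \<le> p x + p y" 
           "\<And>s x. x \<in> X \<Longrightarrow> 0 < s \<Longrightarrow> p (scale s x) \<le> s * p x"
    and le: "\<And>x. x \<in> X \<Longrightarrow> L x = 0 \<Longrightarrow> \<psi> x \<le> p x"
  obtains c where "\<And>x. x \<in> X \<Longrightarrow> \<psi> x - c * L x \<le> p x"
proof (cases "\<exists>x0\<in>X. L x0 > 0")
  case False
  have "L x = 0" if "x \<in> X" for x
  proof (rule ccontr)
    assume "L x \<noteq> 0"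
    with False that have "L x < 0" by force
    then have "L (scale (-1) x) > 0" using L(2) that by simp
    with False X(2) that show False by blast
  qed
  then show ?thesis using le by (intro that[of 0]) auto
next
  case True
  then obtain x0 where x0: "x0 \<in> X" "L x0 > 0" by blast
  let ?q = "\<lambda>x. (\<psi> x - p x) / L x"
  let ?S = "?q ` {x \<in> X. L x > 0}"
  have key: "?q x \<le> ?q y" if x: "x \<in> X" "L x > 0" and y: "y \<in> X" "L y < 0" for x y
  proof -
    define x' where "x' = scale (1 / L x) x"
    define y' where "y' = scale (1 / - L y) y"
    have mem: "x' \<in> X" "y' \<in> X" by (auto simp: x'_def y'_def X x y)
    have "L (x' + y') = 0" unfolding L(1)[OF mem] using x y by (simp add: x'_def y'_def L)
    then have "\<psi> (x' + y') \<le> p (x' + y')" using le X(1)[OF mem] by blast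
    then have "\<psi> x' + \<psi> y' \<le> p x' + p y'" using p(1)[OF mem] \<psi>(1)[OF mem] by linarith
    moreover have "p x' \<le> (1 / L x) * p x" "p y' \<le> (1 / - L y) * p y"
      unfolding x'_def y'_def by (rule p(2); use x y in simp)+
    moreover have "\<psi> x' = (1 / L x) * \<psi> x" "\<psi> y' = (1 / - L y) * \<psi> y"
      unfolding x'_def y'_def using x y by (auto simp: \<psi>)
    ultimately have "(1 / L x) * \<psi> x + (1 / - L y) * \<psi> y \<le> (1 / L x) * p x + (1 / - L y) * p y"
      by linarith
    then show ?thesis by (simp add: diff_divide_distrib)
  qed
  have m0: "scale (-1) x0 \<in> X" "L (scale (-1) x0) < 0" using x0 X L by auto
  have bdd: "bdd_above ?S" using key[OF _ _ m0] by (auto intro!: bdd_aboveI)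
  show ?thesis
  proof (rule that[of "Sup ?S"])
    fix x assume x: "x \<in> X"
    consider "L x = 0" | "L x > 0" | "L x < 0" by linarith
    then show "\<psi> x - Sup ?S * L x \<le> p x"
    proof cases
      case 1 then show ?thesis using le x by simp
    next
      case 2
      then have "?q x \<le> Sup ?S" using x bdd by (intro cSup_upper) auto
      then show ?thesis using 2 by (simp add: field_simps)
    next
      case 3
      have "Sup ?S \<le> ?q x" using x0 key[OF _ _ x 3] by (intro cSup_least) auto
      then show ?thesis using 3 by (simp add: field_simps)
    qed
  qed
qed

text \<open>
  The real step is taken for \<open>Re L\<close> on the kernel of \<open>Im L\<close> and then for \<open>Im L\<close>. A bound for the real
  part is a bound for the modulus, because the argument may be multiplied by a unimodular number.
\<close>
lemma sublinear_complex_one_step: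
  fixes scale :: "complex \<Rightarrow> 'v::ab_semigroup_add \<Rightarrow> 'v" and \<psi> L :: "'v \<Rightarrow> complex" and p :: "'v \<Rightarrow> real"
  assumes X: "\<And>x y. x \<in> X \<Longrightarrow> y \<in> X \<Longrightarrow> x + y \<in> X" "\<And>s x. x \<in> X \<Longrightarrow> scale s x \<in> X"
    and \<psi>: "\<And>x y. x \<in> X \<Longrightarrow> y \<in> X \<Longrightarrow> \<psi> (x + y) = \<psi> x + \<psi> y" "\<And>s x. x \<in> X \<Longrightarrow> \<psi> (scale s x) = s * \<psi> x"
    and L: "\<And>x y. x \<in> X \<Longrightarrow> y \<in> X \<Longrightarrow> L (x + y) = L x + L y" "\<And>s x. x \<in> X \<Longrightarrow> L (scale s x) = s * L x"
    and p: "\<And>x y. x \<in> X \<Longrightarrow> y \<in> X \<Longrightarrow> p (x + y) \<le> p x + p y" 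
           "\<And>s x. x \<in> X \<Longrightarrow> p (scale s x) \<le> cmod s * p x"
    and le: "\<And>x. x \<in> X \<Longrightarrow> L x = 0 \<Longrightarrow> cmod (\<psi> x) \<le> p x"
  obtains c where "\<And>x. x \<in> X \<Longrightarrow> cmod (\<psi> x - c * L x) \<le> p x"
proof -
  let ?sc = "\<lambda>s. scale (complex_of_real s)"
  have pr: "p (?sc s x) \<le> s * p x" if "x \<in> X" "0 < s" for s x
    using p(2)[of x "of_real s"] that by simp
  let ?Y = "{x \<in> X. Im (L x) = 0}"
  obtain a where a: "\<And>x. x \<in> ?Y \<Longrightarrow> Re (\<psi> x) - a * Re (L x) \<le> p x"
  proof (rule sublinear_real_one_step[of ?Y ?sc "\<lambda>x. Re (\<psi> x)" "\<lambda>x. Re (L x)" p])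
    fix x assume "x \<in> ?Y" "Re (L x) = 0"
    then show "Re (\<psi> x) \<le> p x" using le[of x] complex_Re_le_cmod[of "\<psi> x"] by (simp add: complex_eq_iff)
  qed (auto simp: X \<psi> L p pr)
  obtain b where b: "\<And>x. x \<in> X \<Longrightarrow> (Re (\<psi> x) - a * Re (L x)) - b * Im (L x) \<le> p x"
    by (rule sublinear_real_one_step[of X ?sc "\<lambda>x. Re (\<psi> x) - a * Re (L x)" "\<lambda>x. Im (L x)" p])
       (use a in \<open>auto simp: X \<psi> L p pr algebra_simps\<close>)
  define c where "c = Complex a (- b)"
  show ?thesis
  proof (rule that[of c])
    fix x assume x: "x \<in> X"
    define d where "d = \<psi> x - c * L x"
    show "cmod d \<le> p x"
    proof (cases "d = 0")
      case True
      have "0 \<le> p x"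
        using b[OF x] b[OF X(2)[OF x, of "-1"]] p(2)[OF x, of "-1"] \<psi>(2)[OF x, of "-1"] L(2)[OF x, of "-1"] 
        by simp
      then show ?thesis using True by simp
    next
      case False
      \<comment> \<open>This factor rotates \<open>d\<close> onto the positive real axis.\<close>
      define u where "u = cnj d / cmod d"
      have u: "cmod u = 1" using False by (simp add: u_def norm_divide)
      have "u * d = cmod d" using False 
        by (simp add: u_def mult.commute complex_norm_square[symmetric] power2_eq_square)
      then have "cmod d = Re (u * d)" by simp
      also have "\<dots> = Re (\<psi> (scale u x)) - a * Re (L (scale u x)) - b * Im (L (scale u x))"
        unfolding \<psi>(2)[OF x] L(2)[OF x] d_def by (simp add: c_def algebra_simps)
      also have "\<dots> \<le> p (scale u x)" by (rule b[OF X(2)[OF x]])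
      also have "\<dots> \<le> p x" using p(2)[OF x, of u] u by simp
      finally show ?thesis .
    qed
  qed
qed

text \<open>
  Induction on the number of functionals: the induction hypothesis is applied on the kernel of one of them,
  and the one-dimensional step passes from this kernel to all of \<open>X\<close>. It is the Hahn-Banach theorem for a subspace
  of finite codimension, so that no maximality argument enters.
\<close>
lemma sublinear_finite_codimension:
  fixes scale :: "complex \<Rightarrow> 'v::ab_semigroup_add \<Rightarrow> 'v" and \<psi> :: "'v \<Rightarrow> complex" 
    and L :: "'i \<Rightarrow> 'v \<Rightarrow> complex" and p :: "'v \<Rightarrow> real"
  assumes "finite I"
    and X: "\<And>x y. x \<in> X \<Longrightarrow> y \<in> X \<Longrightarrow> x + y \<in> X" "\<And>s x. x \<in> X \<Longrightarrow> scale s x \<in> X"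
    and \<psi>: "\<And>x y. x \<in> X \<Longrightarrow> y \<in> X \<Longrightarrow> \<psi> (x + y) = \<psi> x + \<psi> y" "\<And>s x. x \<in> X \<Longrightarrow> \<psi> (scale s x) = s * \<psi> x"
    and L: "\<And>i x y. x \<in> X \<Longrightarrow> y \<in> X \<Longrightarrow> L i (x + y) = L i x + L i y" 
           "\<And>i s x. x \<in> X \<Longrightarrow> L i (scale s x) = s * L i x"
    and p: "\<And>x y. x \<in> X \<Longrightarrow> y \<in> X \<Longrightarrow> p (x + y) \<le> p x + p y" 
           "\<And>s x. x \<in> X \<Longrightarrow> p (scale s x) \<le> cmod s * p x"
    and le: "\<And>x. x \<in> X \<Longrightarrow> (\<forall>i\<in>I. L i x = 0) \<Longrightarrow> cmod (\<psi> x) \<le> p x"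
  shows "\<exists>c. \<forall>x\<in>X. cmod (\<psi> x - (\<Sum>i\<in>I. c i * L i x)) \<le> p x"
  using assms
proof (induction I arbitrary: X rule: finite_induct)
  case empty
  then show ?case by simp
next
  case (insert j I)
  let ?Y = "{x \<in> X. L j x = 0}"
  have "\<exists>c. \<forall>x\<in>?Y. cmod (\<psi> x - (\<Sum>i\<in>I. c i * L i x)) \<le> p x"
    by (rule insert.IH) (use insert.prems in auto)
  then obtain c where c: "\<And>x. x \<in> ?Y \<Longrightarrow> cmod (\<psi> x - (\<Sum>i\<in>I. c i * L i x)) \<le> p x" by blast
  obtain d where d: "\<And>x. x \<in> X \<Longrightarrow> cmod ((\<psi> x - (\<Sum>i\<in>I. c i * L i x)) - d * L j x) \<le> p x"
  proof (rule sublinear_complex_one_step[of X scale "\<lambda>x. \<psi> x - (\<Sum>i\<in>I. c i * L i x)" "L j" p])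
    fix x y assume "x \<in> X" "y \<in> X"
    then show "\<psi> (x + y) - (\<Sum>i\<in>I. c i * L i (x + y)) =
      (\<psi> x - (\<Sum>i\<in>I. c i * L i x)) + (\<psi> y - (\<Sum>i\<in>I. c i * L i y))"
      by (simp add: insert.prems algebra_simps sum.distrib)
  next
    fix s x assume "x \<in> X"
    then show "\<psi> (scale s x) - (\<Sum>i\<in>I. c i * L i (scale s x)) = s * (\<psi> x - (\<Sum>i\<in>I. c i * L i x))"
      by (simp add: insert.prems algebra_simps sum_distrib_left)
  qed (use c insert.prems in auto)
  have "\<psi> x - (\<Sum>i\<in>insert j I. (c(j := d)) i * L i x) = (\<psi> x - (\<Sum>i\<in>I. c i * L i x)) - d * L j x" for x
  proof -
    have "(\<Sum>i\<in>I. (c(j := d)) i * L i x) = (\<Sum>i\<in>I. c i * L i x)"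
      by (rule sum.cong) (use insert.hyps in auto)
    then show ?thesis using insert.hyps by simp
  qed
  with d have "\<forall>x\<in>X. cmod (\<psi> x - (\<Sum>i\<in>insert j I. (c(j := d)) i * L i x)) \<le> p x" by metis
  then show ?case by blast
qed

section \<open>bp-continuous functionals\<close>

lemma holomorphic_several_add:
  assumes "holomorphic_several U g" "holomorphic_several U h"
  shows "holomorphic_several U (\<lambda>z. g z + h z)"
  unfolding holomorphic_several_def
proof
  fix z assume z: "z \<in> U"
  note g = holomorphic_several_has_derivative[OF assms(1) z] and h = holomorphic_several_has_derivative[OF assms(2) z]
  show "\<exists>A. ((\<lambda>z. g z + h z) has_derivative A) (at z) \<and> (\<forall>c v. A (c *s v) = c * A v)"
    using has_derivative_add[OF g(1) h(1)] g(2) h(2) by (intro exI conjI) (auto simp: algebra_simps)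
qed

lemma holomorphic_several_cmult:
  assumes "holomorphic_several U g"
  shows "holomorphic_several U (\<lambda>z. c * g z)"
  unfolding holomorphic_several_def
proof
  fix z assume z: "z \<in> U"
  note g = holomorphic_several_has_derivative[OF assms z]
  show "\<exists>A. ((\<lambda>z. c * g z) has_derivative A) (at z) \<and> (\<forall>c v. A (c *s v) = c * A v)"
    using has_derivative_mult_right[OF g(1)] g(2) by (intro exI conjI) (auto simp: algebra_simps)
qed

definition hnorm :: "(complex ^ 'd) set \<Rightarrow> (complex ^ 'd \<Rightarrow> complex) \<Rightarrow> real" where
  "hnorm U g = enn2real (sup_norm U g)"

lemma hnorm_nonneg: "0 \<le> hnorm U g" by (simp add: hnorm_def)

lemma sup_norm_eq_hnorm: "g \<in> Hinf U \<Longrightarrow> sup_norm U g = ennreal (hnorm U g)"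
  by (simp add: hnorm_def Hinf_def)

lemma sup_norm_le:
  "(\<And>z. z \<in> U \<Longrightarrow> cmod (g z) \<le> C) \<Longrightarrow> sup_norm U g \<le> ennreal C"
  unfolding sup_norm_def by (intro SUP_least ennreal_leI)

lemma hnorm_le:
  assumes "0 \<le> C" "\<And>z. z \<in> U \<Longrightarrow> cmod (g z) \<le> C"
  shows "hnorm U g \<le> C"
proof -
  have "sup_norm U g \<le> ennreal C" by (rule sup_norm_le[OF assms(2)])
  from enn2real_mono[OF this] show ?thesis using assms(1) by (simp add: hnorm_def)
qed

lemma le_hnorm: 
  assumes "g \<in> Hinf U" "z \<in> U"
  shows "cmod (g z) \<le> hnorm U g"
proof -
  have "ennreal (cmod (g z)) \<le> sup_norm U g" unfolding sup_norm_def by (rule SUP_upper[OF assms(2)])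
  then have "ennreal (cmod (g z)) \<le> ennreal (hnorm U g)" using sup_norm_eq_hnorm[OF assms(1)] by simp
  then show ?thesis by (simp add: ennreal_le_iff hnorm_nonneg)
qed

lemma HinfI:
  assumes "holomorphic_several U g" "\<And>z. z \<in> U \<Longrightarrow> cmod (g z) \<le> C"
  shows "g \<in> Hinf U"
  using assms(1) sup_norm_le[of U g C, OF assms(2)] by (auto simp: Hinf_def intro: order.strict_trans1)

lemma HinfD: "g \<in> Hinf U \<Longrightarrow> holomorphic_several U g"
  by (simp add: Hinf_def)

lemma Hinf_add: 
  assumes "g \<in> Hinf U" "h \<in> Hinf U"
  shows "(\<lambda>z. g z + h z) \<in> Hinf U" "hnorm U (\<lambda>z. g z + h z) \<le> hnorm U g + hnorm U h"
proof -
  have le: "cmod (g z + h z) \<le> hnorm U g + hnorm U h" if "z \<in> U" for z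
    using norm_triangle_ineq[of "g z" "h z"] le_hnorm[OF assms(1) that] le_hnorm[OF assms(2) that] by linarith
  show "(\<lambda>z. g z + h z) \<in> Hinf U" 
    by (rule HinfI[OF holomorphic_several_add[OF HinfD[OF assms(1)] HinfD[OF assms(2)]] le])
  show "hnorm U (\<lambda>z. g z + h z) \<le> hnorm U g + hnorm U h"
    by (rule hnorm_le[OF _ le]) (simp add: hnorm_nonneg)
qed

lemma Hinf_cmult: 
  assumes "g \<in> Hinf U"
  shows "(\<lambda>z. c * g z) \<in> Hinf U" "hnorm U (\<lambda>z. c * g z) \<le> cmod c * hnorm U g"
proof -
  have le: "cmod (c * g z) \<le> cmod c * hnorm U g" if "z \<in> U" for z
    using le_hnorm[OF assms that] by (simp add: norm_mult mult_left_mono)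
  show "(\<lambda>z. c * g z) \<in> Hinf U" 
    by (rule HinfI[OF holomorphic_several_cmult[OF HinfD[OF assms]] le])
  show "hnorm U (\<lambda>z. c * g z) \<le> cmod c * hnorm U g"
    by (rule hnorm_le[OF _ le]) (simp add: hnorm_nonneg)
qed

lemma zero_Hinf: "(\<lambda>z. 0) \<in> Hinf U"
  by (rule HinfI[where C = 0]) (auto simp: holomorphic_several_def intro!: exI[of _ "\<lambda>_. 0"])

lemma Hinf_functionalD:
  assumes "Hinf_functional U \<phi>"
  shows "g \<in> Hinf U \<Longrightarrow> h \<in> Hinf U \<Longrightarrow> (\<And>z. z \<in> U \<Longrightarrow> g z = h z) \<Longrightarrow> \<phi> g = \<phi> h"
    and "g \<in> Hinf U \<Longrightarrow> h \<in> Hinf U \<Longrightarrow> \<phi> (\<lambda>z. g z + h z) = \<phi> g + \<phi> h"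
    and "g \<in> Hinf U \<Longrightarrow> \<phi> (\<lambda>z. c * g z) = c * \<phi> g"
    and "\<phi> (\<lambda>z. 0) = 0"
proof -
  show "g \<in> Hinf U \<Longrightarrow> h \<in> Hinf U \<Longrightarrow> (\<And>z. z \<in> U \<Longrightarrow> g z = h z) \<Longrightarrow> \<phi> g = \<phi> h"
   and "g \<in> Hinf U \<Longrightarrow> h \<in> Hinf U \<Longrightarrow> \<phi> (\<lambda>z. g z + h z) = \<phi> g + \<phi> h"
   and c: "g \<in> Hinf U \<Longrightarrow> \<phi> (\<lambda>z. c * g z) = c * \<phi> g" for c g
    using assms unfolding Hinf_functional_def by blast+
  show "\<phi> (\<lambda>z. 0) = 0" using c[OF zero_Hinf, of 0] by simp
qed

lemma functional_eq_zero_of_hnorm_zero: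
  assumes "Hinf_functional U \<phi>" "g \<in> Hinf U" "hnorm U g = 0"
  shows "\<phi> g = 0"
proof -
  have "g z = 0" if "z \<in> U" for z using le_hnorm[OF assms(2) that] assms(3) by simp
  then have "\<phi> g = \<phi> (\<lambda>z. 0)" by (intro Hinf_functionalD(1)[OF assms(1,2) zero_Hinf])
  then show ?thesis using Hinf_functionalD(4)[OF assms(1)] by simp
qed

text \<open>
  Uniformly bounded holomorphic functions are equicontinuous at each point of \<open>U\<close>, hence convergence to
  0 spreads from a dense set to all of \<open>U\<close>.
\<close>
lemma tendsto_zero_of_dense:
  fixes G :: "nat \<Rightarrow> complex ^ 'd \<Rightarrow> complex"
  assumes "open U" and dense: "U \<subseteq> closure D" and hol: "\<And>n. holomorphic_several U (G n)"
    and C: "\<And>n z. z \<in> U \<Longrightarrow> cmod (G n z) \<le> C" and lim: "\<And>d. d \<in> D \<Longrightarrow> (\<lambda>n. G n d) \<longlonglongrightarrow> 0"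
    and z: "z \<in> U"
  shows "(\<lambda>n. G n z) \<longlonglongrightarrow> 0"
proof (rule LIMSEQ_I)
  fix e :: real assume e: "e > 0"
  obtain r where r: "r > 0" "ball z r \<subseteq> U" using \<open>open U\<close> z open_contains_ball by meson
  have C0: "C \<ge> 0" using C[OF z] norm_ge_zero order_trans by blast
  define L where "L = 6 * C / r + 1"
  define \<delta> where "\<delta> = min (r/2) (e / 2 / L)"
  have pos: "L > 0" using C0 r by (simp add: L_def add_nonneg_pos)
  then have "\<delta> > 0" using r e by (simp add: \<delta>_def)
  then obtain d where d: "d \<in> D" "dist d z < \<delta>"
    using dense z closure_approachable by blast
  have le: "cmod (G n z) \<le> cmod (G n d) + e / 2" for n
  proof -
    have "cmod (G n (z + (d - z)) - G n z) \<le> 6 * C / r * norm (d - z)"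
    proof (rule holomorphic_lipschitz_bound)
      show "holomorphic_several (ball z r) (G n)" by (rule holomorphic_several_subset[OF hol r(2)])
      show "norm (d - z) < r / 2" using d by (simp add: \<delta>_def dist_norm)
    qed (use C r in blast)
    also have "\<dots> \<le> L * \<delta>"
      using d C0 r pos by (intro mult_mono) (auto simp: dist_norm L_def)
    also have "\<dots> \<le> L * (e / 2 / L)"
      using pos by (intro mult_left_mono) (auto simp: \<delta>_def)
    also have "\<dots> = e / 2" using pos by simp
    finally have "cmod (G n d - G n z) \<le> e / 2" by simp
    then show ?thesis using norm_triangle_sub[of "G n z" "G n d"] by (simp add: norm_minus_commute)
  qed
  obtain N where "\<And>n. n \<ge> N \<Longrightarrow> cmod (G n d - 0) < e / 2"
    using LIMSEQ_D[OF lim[OF d(1)], of "e/2"] e by auto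
  then have "\<forall>n\<ge>N. cmod (G n z - 0) < e" using le by (smt (verit) diff_zero field_sum_of_halves)
  then show "\<exists>N. \<forall>n\<ge>N. cmod (G n z - 0) < e" by blast
qed

text \<open>
  Otherwise, for a countable dense set \<open>d\<^sub>0, d\<^sub>1, \<dots>\<close>, there would be functions \<open>G\<^sub>n\<close> of norm at most 1
  vanishing at \<open>d\<^sub>0, \<dots>, d\<^sub>n\<close> with \<open>\<bar>\<phi> (G\<^sub>n)\<bar> > \<epsilon>\<close>. These converge to 0 on the dense set, hence everywhere,
  and bp-continuity of \<open>\<phi>\<close> is violated.
\<close>
lemma bp_continuous_small_on_finite_annihilator:
  fixes U :: "(complex ^ 'd) set"
  assumes "open U" "Hinf_functional U \<phi>" "bp_continuous U \<phi>" and \<epsilon>: "0 < \<epsilon>"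
  shows "\<exists>Z. finite Z \<and> Z \<subseteq> U \<and> (\<forall>g\<in>Hinf U. (\<forall>z\<in>Z. g z = 0) \<longrightarrow> cmod (\<phi> g) \<le> \<epsilon> * hnorm U g)"
proof (rule ccontr)
  assume neg: "\<not> ?thesis"
  note \<phi> = Hinf_functionalD[OF assms(2)]
  obtain D where D: "countable D" "D \<subseteq> U" "U \<subseteq> closure D" using separable by blast
  have "\<exists>g. g \<in> Hinf U \<and> (\<forall>z\<in>U. cmod (g z) \<le> 1) \<and> \<epsilon> < cmod (\<phi> g) \<and> (\<forall>k\<le>n. from_nat_into D k \<in> D \<longrightarrow> g (from_nat_into D k) = 0)" for n
  proof -
    let ?Z = "from_nat_into D ` {..n} \<inter> D"
    obtain g where g: "g \<in> Hinf U" "\<And>z. z \<in> ?Z \<Longrightarrow> g z = 0" "\<epsilon> * hnorm U g < cmod (\<phi> g)"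
      using neg D(2) by (metis (no_types, lifting) finite_Int finite_atMost finite_imageI inf.coboundedI2 not_le)
    have "hnorm U g \<noteq> 0" using functional_eq_zero_of_hnorm_zero[OF assms(2) g(1)] g(3) by auto
    then have pos: "hnorm U g > 0" using hnorm_nonneg[of U g] by simp
    define s where "s = complex_of_real (1 / hnorm U g)"
    have s: "cmod s = 1 / hnorm U g" using pos by (simp add: s_def norm_divide)
    let ?g = "\<lambda>z. s * g z"
    have "cmod (?g z) \<le> 1" if "z \<in> U" for z
      using le_hnorm[OF g(1) that] pos by (simp add: norm_mult s)
    moreover have "\<epsilon> < cmod (\<phi> ?g)" 
      using g(3) pos unfolding \<phi>(3)[OF g(1)] by (simp add: norm_mult s field_simps)
    ultimately show ?thesis using Hinf_cmult(1)[OF g(1)] g(2) by (intro exI[of _ ?g]) auto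
  qed
  then obtain G where G: "\<And>n. G n \<in> Hinf U" "\<And>n z. z \<in> U \<Longrightarrow> cmod (G n z) \<le> 1" 
    "\<And>n. \<epsilon> < cmod (\<phi> (G n))" 
    "\<And>n k. k \<le> n \<Longrightarrow> from_nat_into D k \<in> D \<Longrightarrow> G n (from_nat_into D k) = 0"
    by metis
  have lim: "(\<lambda>n. G n d) \<longlonglongrightarrow> 0" if d: "d \<in> D" for d
  proof -
    obtain k where "from_nat_into D k = d" using from_nat_into_surj[OF D(1) d] by blast
    then have "eventually (\<lambda>n. G n d = 0) sequentially"
      using G(4)[of k] d by (auto intro!: eventually_sequentiallyI[of k])
    then show ?thesis by (rule tendsto_eventually)
  qed
  have "bp_converges U G (\<lambda>z. 0)"
    unfolding bp_converges_def
  proof (intro conjI ballI)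
    show "(\<lambda>n. G n z) \<longlonglongrightarrow> 0" if "z \<in> U" for z
      using tendsto_zero_of_dense[OF assms(1) D(3) HinfD[OF G(1)] G(2) lim that] .
    have "(SUP n. sup_norm U (G n)) \<le> ennreal 1" by (intro SUP_least sup_norm_le G(2))
    then show "(SUP n. sup_norm U (G n)) < \<infinity>" by (simp add: order.strict_trans1)
  qed
  then have "(\<lambda>n. \<phi> (G n)) \<longlonglongrightarrow> \<phi> (\<lambda>z. 0)"
    using assms(3) G(1) zero_Hinf unfolding bp_continuous_def by blast
  then have "(\<lambda>n. cmod (\<phi> (G n))) \<longlonglongrightarrow> 0" by (simp add: \<phi>(4) tendsto_norm_zero)
  then have "\<epsilon> \<le> 0" by (rule LIMSEQ_le_const) (use G(3) in \<open>auto intro: less_imp_le\<close>)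
  with \<epsilon> show False by simp
qed

text \<open>
  The Hahn-Banach argument, applied to finitely many point evaluations on whose common kernel \<open>\<phi>\<close> is small.
  This reduces statements about \<open>\<phi>\<close> to point evaluations, for which they are evident, because
  norm convergence carries them over.
\<close>
lemma bp_continuous_approx:
  fixes U :: "(complex ^ 'd) set"
  assumes "open U" "Hinf_functional U \<phi>" "bp_continuous U \<phi>" "0 < \<epsilon>"
  shows "\<exists>Z c. finite Z \<and> Z \<subseteq> U \<and> (\<forall>g\<in>Hinf U. cmod (\<phi> g - (\<Sum>z\<in>Z. c z * g z)) \<le> \<epsilon> * hnorm U g)"
proof -
  obtain Z where Z: "finite Z" "Z \<subseteq> U" 
    and small: "\<And>g. g \<in> Hinf U \<Longrightarrow> (\<forall>z\<in>Z. g z = 0) \<Longrightarrow> cmod (\<phi> g) \<le> \<epsilon> * hnorm U g"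
    using bp_continuous_small_on_finite_annihilator[OF assms] by blast
  note \<phi> = Hinf_functionalD[OF assms(2)]
  have "\<exists>c. \<forall>g\<in>Hinf U. cmod (\<phi> g - (\<Sum>z\<in>Z. c z * g z)) \<le> \<epsilon> * hnorm U g"
  proof (rule sublinear_finite_codimension[OF Z(1), where scale = "\<lambda>c g z. c * g z"])
    show "\<epsilon> * hnorm U (g + h) \<le> \<epsilon> * hnorm U g + \<epsilon> * hnorm U h" if "g \<in> Hinf U" "h \<in> Hinf U" for g h
      using mult_left_mono[OF Hinf_add(2)[OF that], of \<epsilon>] \<open>0 < \<epsilon>\<close> 
      by (simp add: plus_fun_def distrib_left)
    show "\<epsilon> * hnorm U (\<lambda>z. s * g z) \<le> cmod s * (\<epsilon> * hnorm U g)" if "g \<in> Hinf U" for s g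
      using mult_left_mono[OF Hinf_cmult(2)[OF that], of \<epsilon> s] \<open>0 < \<epsilon>\<close> by (simp add: mult_ac)
    show "\<phi> (g + h) = \<phi> g + \<phi> h" if "g \<in> Hinf U" "h \<in> Hinf U" for g h
      using \<phi>(2)[OF that] by (simp add: plus_fun_def)
    show "g + h \<in> Hinf U" if "g \<in> Hinf U" "h \<in> Hinf U" for g h
      using Hinf_add(1)[OF that] by (simp add: plus_fun_def)
    show "(g + h) z = g z + h z" for g h :: "complex ^ 'd \<Rightarrow> complex" and z
      by (simp add: plus_fun_def)
  qed (simp_all only: Hinf_cmult(1) \<phi>(3) small)
  with Z show ?thesis by blast
qed

text \<open>
  Normalise \<open>g\<close>. If \<open>g\<close> vanishes on \<open>U\<close> this is impossible, but then \<open>\<phi> g = 0\<close>, since \<open>\<phi>\<close>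
  depends on the values on \<open>U\<close> only.
\<close>
lemma cmod_functional_le:
  assumes "Hinf_functional U \<phi>" "g \<in> Hinf U"
  shows "ennreal (cmod (\<phi> g)) \<le> functional_norm U \<phi> * sup_norm U g"
proof (cases "hnorm U g = 0")
  case True
  then show ?thesis using functional_eq_zero_of_hnorm_zero[OF assms] by simp
next
  case False
  then have pos: "hnorm U g > 0" using hnorm_nonneg[of U g] by simp
  define s where "s = complex_of_real (1 / hnorm U g)"
  have s: "cmod s = 1 / hnorm U g" using pos by (simp add: s_def norm_divide)
  let ?g = "\<lambda>z. s * g z"
  have "cmod (?g z) \<le> 1" if "z \<in> U" for z
    using le_hnorm[OF assms(2) that] pos by (simp add: norm_mult s)
  then have "sup_norm U ?g \<le> ennreal 1" by (rule sup_norm_le)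
  then have "?g \<in> {g \<in> Hinf U. sup_norm U g \<le> 1}" using Hinf_cmult(1)[OF assms(2)] by simp
  then have "ennreal (cmod (\<phi> ?g)) \<le> functional_norm U \<phi>"
    unfolding functional_norm_def by (rule SUP_upper)
  then have "ennreal (cmod (\<phi> ?g)) * sup_norm U g \<le> functional_norm U \<phi> * sup_norm U g"
    by (rule mult_right_mono) simp
  moreover have "ennreal (cmod (\<phi> ?g)) * sup_norm U g = ennreal (cmod (\<phi> ?g) * hnorm U g)"
    unfolding sup_norm_eq_hnorm[OF assms(2)] by (simp add: ennreal_mult' hnorm_nonneg)
  moreover have "cmod (\<phi> ?g) * hnorm U g = cmod (\<phi> g)"
    unfolding Hinf_functionalD(3)[OF assms] using pos by (simp add: norm_mult s)
  ultimately show ?thesis by simp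
qed

section \<open>Application to holomorphic families\<close>

text \<open>
  Countably many exceptional null sets, one for each point of a dense set, suffice, since
  continuity in \<open>z\<close> extends the bound from the dense set to \<open>U\<close>.
\<close>
lemma AE_all_bounded_of_pointwise:
  fixes f :: "complex ^ 'd \<Rightarrow> 'a \<Rightarrow> complex"
  assumes cont: "\<And>t z. t \<in> space M \<Longrightarrow> z \<in> U \<Longrightarrow> isCont (\<lambda>z. f z t) z"
    and bound: "\<And>z. z \<in> U \<Longrightarrow> AE t in M. cmod (f z t) \<le> C"
  shows "AE t in M. \<forall>z\<in>U. cmod (f z t) \<le> C"
proof -
  obtain D where D: "countable D" "D \<subseteq> U" "U \<subseteq> closure D" using separable by blast
  have "AE t in M. \<forall>d\<in>D. cmod (f d t) \<le> C"
    using D bound by (subst AE_ball_countable) auto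
  then show ?thesis using AE_space
  proof (eventually_elim, intro ballI)
    fix t z assume t: "\<forall>d\<in>D. cmod (f d t) \<le> C" "t \<in> space M" and z: "z \<in> U"
    obtain x where x: "\<And>n. x n \<in> D" "x \<longlonglongrightarrow> z"
      using D(3) z closure_sequential by blast
    have "(\<lambda>n. cmod (f (x n) t)) \<longlonglongrightarrow> cmod (f z t)"
      by (intro tendsto_norm isCont_tendsto_compose[OF cont[OF t(2) z] x(2)])
    then show "cmod (f z t) \<le> C"
      by (rule LIMSEQ_le_const2) (use t x in auto)
  qed
qed

lemma Linf_integral_tendsto:
  fixes u :: "nat \<Rightarrow> 'a \<Rightarrow> complex"
  assumes u: "\<And>k. u k \<in> Linf M" and v: "v \<in> Linf M"
    and close: "\<And>k. AE t in M. cmod (v t - u k t) \<le> e k" and e: "e \<longlonglongrightarrow> 0"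
    and g: "integrable M g"
  shows "(\<lambda>k. \<integral>t. u k t * g t \<partial>M) \<longlonglongrightarrow> (\<integral>t. v t * g t \<partial>M)"
proof (rule Lim_transform2[OF tendsto_const])
  have int: "integrable M (\<lambda>t. w t * g t)" if "w \<in> Linf M" for w
    using integrable_bounded_mult(1)[OF LinfD[OF that] _ g] Linf_AE_bound[OF that] by blast
  have "(\<lambda>k. (\<integral>t. (v t - u k t) * g t \<partial>M)) \<longlonglongrightarrow> 0"
  proof (rule Lim_null_comparison)
    show "\<forall>\<^sub>F k in sequentially. norm (\<integral>t. (v t - u k t) * g t \<partial>M) \<le> e k * (\<integral>t. cmod (g t) \<partial>M)"
      using LinfD[OF v] LinfD[OF u]
      by (intro always_eventually allI integrable_bounded_mult(2)[OF _ close g] borel_measurable_diff)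
    show "(\<lambda>k. e k * (\<integral>t. cmod (g t) \<partial>M)) \<longlonglongrightarrow> 0"
      by (rule tendsto_mult_left_zero[OF e])
  qed
  then show "(\<lambda>k. (\<integral>t. v t * g t \<partial>M) - (\<integral>t. u k t * g t \<partial>M)) \<longlonglongrightarrow> 0"
    by (simp add: left_diff_distrib int v u)
qed

text \<open>
  The sequence is eventually in each subbasic neighbourhood of its limit, because its integrals
  against \<open>g\<close> converge, and this property passes to finite intersections and unions.
\<close>
lemma Linf_weak_closureI:
  assumes u: "\<And>k. u k \<in> S" "\<And>k. u k \<in> Linf M" and v: "v \<in> Linf M"
    and close: "\<And>k. AE t in M. cmod (v t - u k t) \<le> e k" and e: "e \<longlonglongrightarrow> 0"
  shows "v \<in> Linf_weak_topology M closure_of S"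
proof -
  let ?B = "{{u \<in> Linf M. (\<integral>t. u t * g t \<partial>M) \<in> W} | g W. integrable M g \<and> open W}"
  note lim = Linf_integral_tendsto[OF u(2) v close e]
  have ev: "\<forall>\<^sub>F k in sequentially. u k \<in> T" if "generate_topology_on ?B T" "v \<in> T" for T
    using that
  proof (induction rule: generate_topology_on.induct)
    case (Basis T)
    then obtain g W where T: "T = {u \<in> Linf M. (\<integral>t. u t * g t \<partial>M) \<in> W}" "integrable M g" "open W" by blast
    then have "\<forall>\<^sub>F k in sequentially. (\<integral>t. u k t * g t \<partial>M) \<in> W"
      using Basis.prems by (intro topological_tendstoD[OF lim]) auto
    then show ?case by eventually_elim (use T u in auto)
  next
    case (UN K)
    then obtain k where "k \<in> K" "v \<in> k" by blast
    with UN.IH have "\<forall>\<^sub>F n in sequentially. u n \<in> k" by blast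
    then show ?case by eventually_elim (use \<open>k \<in> K\<close> in blast)
  qed (auto intro: eventually_conj)
  have "v \<in> \<Union>?B"
    using v by (intro UnionI[of "Linf M"]) (auto intro!: exI[of _ "\<lambda>_. 0"] exI[of _ UNIV])
  then show ?thesis
    unfolding in_closure_of Linf_weak_topology_def topology_generated_by_topspace openin_topology_generated_by_iff
    using ev u(1) eventually_happens'[OF sequentially_bot] by blast
qed

lemma sum_in_complex_span:
  assumes "finite Z" "Z \<subseteq> U"
  shows "(\<lambda>t. \<Sum>z\<in>Z. c z * f z t) \<in> complex_span (f ` U)"
  using assms
proof (induction Z rule: finite_induct)
  interpret vector_space "\<lambda>(c::complex) u (t::'b). c * u t" by (rule vector_space_complex_fun)
  case empty
  then show ?case using span_zero by (simp add: zero_fun_def)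
next
  interpret vector_space "\<lambda>(c::complex) u (t::'b). c * u t" by (rule vector_space_complex_fun)
  case (insert z Z)
  have "(\<lambda>t. c z * f z t) + (\<lambda>t. \<Sum>z\<in>Z. c z * f z t) \<in> complex_span (f ` U)"
    by (rule span_add[OF span_scale[OF span_base]]) (use insert in auto)
  then show ?case using insert.hyps by (simp add: plus_fun_def)
qed

theorem theorem4p4:
  fixes M :: "'a measure"
    and U :: "(complex, 'd::{finite,linorder}) vec set"
    and f :: "(complex, 'd) vec \<Rightarrow> 'a \<Rightarrow> complex"
    and \<alpha> :: "'d \<Rightarrow> nat"
    and a :: "(complex, 'd) vec"
    and \<phi> :: "((complex, 'd) vec \<Rightarrow> complex) \<Rightarrow> complex"
  assumes "semi_finite M"
    and "open U" "U \<noteq> {}"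
    and "\<And>z. z \<in> U \<Longrightarrow> f z \<in> borel_measurable M"
    and "(SUP z\<in>U. Linf_norm M (f z)) < \<infinity>"
    and "\<And>t. t \<in> space M \<Longrightarrow> (\<lambda>z. f z t) \<in> Hinf U"
    and "a \<in> U"
    and "Hinf_functional U \<phi>" "bp_continuous U \<phi>"
  shows
    "(f \<in> Hinf_Linf M U \<and>
      (AE t in M. Linf_Dmulti M \<alpha> f a t = Dmulti \<alpha> (\<lambda>z. f z t) a)) \<and>
     (\<forall>g :: 'a \<Rightarrow> complex. integrable M g \<longrightarrow>
       (\<forall>z\<in>U. integrable M (\<lambda>t. f z t * g t)) \<and>
       holomorphic_several U (\<lambda>z. \<integral>t. f z t * g t \<partial>M) \<and>
       integrable M (\<lambda>t. Dmulti \<alpha> (\<lambda>z. f z t) a * g t) \<and>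
       Dmulti \<alpha> (\<lambda>z. \<integral>t. f z t * g t \<partial>M) a = (\<integral>t. Dmulti \<alpha> (\<lambda>z. f z t) a * g t \<partial>M)) \<and>
     ((\<lambda>t. \<phi> (\<lambda>z. f z t)) \<in> Linf M \<and>
      Linf_norm M (\<lambda>t. \<phi> (\<lambda>z. f z t)) \<le> functional_norm U \<phi> * (SUP z\<in>U. Linf_norm M (f z)) \<and>
      (\<lambda>t. \<phi> (\<lambda>z. f z t)) \<in> Linf_weak_topology M closure_of complex_span (f ` U)) \<and>
     (\<forall>g :: 'a \<Rightarrow> complex. integrable M g \<longrightarrow>
       integrable M (\<lambda>t. \<phi> (\<lambda>z. f z t) * g t) \<and>
       (\<lambda>z. \<integral>t. f z t * g t \<partial>M) \<in> Hinf U \<and>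
       (\<integral>t. \<phi> (\<lambda>z. f z t) * g t \<partial>M) = \<phi> (\<lambda>z. \<integral>t. f z t * g t \<partial>M))"
proof -
  let ?S = "SUP z\<in>U. Linf_norm M (f z)"
  let ?\<Phi> = "\<lambda>t. \<phi> (\<lambda>z. f z t)"
  define C where "C = enn2real ?S"
  have C0: "0 \<le> C" by (simp add: C_def)
  have C: "ennreal C = ?S" using assms(5) by (simp add: C_def)
  have "AE t in M. cmod (f z t) \<le> C" if z: "z \<in> U" for z
    using Linf_norm_AE[of "f z" M]
  proof eventually_elim
    case (elim t)
    also have "Linf_norm M (f z) \<le> ennreal C" unfolding C by (rule SUP_upper[OF z])
    finally show ?case using C0 by (simp add: ennreal_le_iff)
  qed
  then have bound: "AE t in M. \<forall>z\<in>U. cmod (f z t) \<le> C"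
    using holomorphic_several_continuous[OF HinfD[OF assms(6)]]
    by (intro AE_all_bounded_of_pointwise)
  have fam: "holomorphic_family M U f"
    unfolding holomorphic_family_def
  proof (intro conjI ballI)
    fix z assume "z \<in> U"
    then obtain r where r: "0 < r" "ball z r \<subseteq> U" using \<open>open U\<close> open_contains_ball by meson
    have "AE t in M. \<forall>y\<in>ball z r. cmod (f y t) \<le> C" using bound by eventually_elim (use r in blast)
    with r show "\<exists>r>0. \<exists>C. ball z r \<subseteq> U \<and> (AE t in M. \<forall>y\<in>ball z r. cmod (f y t) \<le> C)" by blast
  qed (use assms(4) HinfD[OF assms(6)] in auto)
  have boundz: "AE t in M. cmod (f z t) \<le> C" if "z \<in> U" for z
    using bound by eventually_elim (use that in blast)
  have fLinf: "f z \<in> Linf M" if "z \<in> U" for z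
    by (rule LinfI[OF assms(4) boundz]) (use that in auto)
  have hn: "AE t in M. hnorm U (\<lambda>z. f z t) \<le> C"
    using bound by eventually_elim (intro hnorm_le C0, blast)
  have GH: "(\<lambda>z. \<integral>t. f z t * g t \<partial>M) \<in> Hinf U" if g: "integrable M g" for g
    by (rule HinfI[OF holomorphic_several_integral_family[OF fam g]
          integrable_bounded_mult(2)[OF assms(4) boundz g]])

  \<comment> \<open>Approximations of \<open>\<phi>\<close> by combinations of point evaluations, with errors \<open>1 / (k + 1)\<close>.\<close>
  have "\<forall>k. \<exists>Z c. finite Z \<and> Z \<subseteq> U \<and> 
      (\<forall>g\<in>Hinf U. cmod (\<phi> g - (\<Sum>z\<in>Z. c z * g z)) \<le> 1 / real (Suc k) * hnorm U g)"
    by (intro allI bp_continuous_approx[OF assms(2,8,9)]) simp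
  then obtain Z c where Z: "\<And>k. finite (Z k)" "\<And>k. Z k \<subseteq> U" and approx: "\<And>k g. g \<in> Hinf U \<Longrightarrow> 
      cmod (\<phi> g - (\<Sum>z\<in>Z k. c k z * g z)) \<le> 1 / real (Suc k) * hnorm U g"
    by metis
  have null: "(\<lambda>k. 1 / real (Suc k) * x) \<longlonglongrightarrow> 0" for x
    using tendsto_mult_left_zero[OF LIMSEQ_Suc[OF lim_const_over_n[of 1]]] by simp
  have conv: "(\<lambda>k. \<Sum>z\<in>Z k. c k z * g z) \<longlonglongrightarrow> \<phi> g" if g: "g \<in> Hinf U" for g
  proof (rule Lim_transform2[OF tendsto_const])
    show "(\<lambda>k. \<phi> g - (\<Sum>z\<in>Z k. c k z * g z)) \<longlonglongrightarrow> 0"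
      by (rule Lim_null_comparison[OF always_eventually null]) (use approx[OF g] in blast)
  qed
  define u where "u = (\<lambda>k t. \<Sum>z\<in>Z k. c k z * f z t)"
  have um: "u k \<in> borel_measurable M" for k
    unfolding u_def using Z assms(4) by (intro borel_measurable_sum borel_measurable_times) auto
  \<comment> \<open>Convergence holds at every \<open>t\<close>, also where \<open>f\<^sub>t\<close> exceeds the common bound, so the limit itself is measurable.\<close>
  have \<Phi>m: "?\<Phi> \<in> borel_measurable M"
  proof (rule borel_measurable_LIMSEQ_metric[OF um])
    show "(\<lambda>k. u k t) \<longlonglongrightarrow> ?\<Phi> t" if "t \<in> space M" for t
      unfolding u_def by (rule conv[OF assms(6)[OF that]])
  qed
  have close: "AE t in M. cmod (?\<Phi> t - u k t) \<le> 1 / real (Suc k) * C" for k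
    using hn AE_space
  proof eventually_elim
    case (elim t)
    have "cmod (?\<Phi> t - u k t) \<le> 1 / real (Suc k) * hnorm U (\<lambda>z. f z t)"
      unfolding u_def by (rule approx[OF assms(6)[OF elim(2)]])
    also have "\<dots> \<le> 1 / real (Suc k) * C" by (rule mult_left_mono[OF elim(1)]) simp
    finally show ?case .
  qed
  have ub: "AE t in M. cmod (u k t) \<le> (\<Sum>z\<in>Z k. cmod (c k z) * C)" for k
    using bound
  proof eventually_elim
    case (elim t)
    then show ?case unfolding u_def using Z 
      by (intro order_trans[OF norm_sum] sum_mono) (auto simp: norm_mult intro!: mult_left_mono)
  qed
  have uLinf: "u k \<in> Linf M" for k by (rule LinfI[OF um ub])
  have "AE t in M. cmod (?\<Phi> t) \<le> 1 / real (Suc 0) * C + (\<Sum>z\<in>Z 0. cmod (c 0 z) * C)"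
    using close[of 0] ub[of 0]
  proof eventually_elim
    case (elim t)
    then show ?case using norm_triangle_sub[of "?\<Phi> t" "u 0 t"] by linarith
  qed
  then have \<Phi>Linf: "?\<Phi> \<in> Linf M" by (rule LinfI[OF \<Phi>m])
  have \<Phi>norm: "Linf_norm M ?\<Phi> \<le> functional_norm U \<phi> * ?S"
  proof (rule Linf_norm_le[OF \<Phi>m])
    show "AE t in M. ennreal (cmod (?\<Phi> t)) \<le> functional_norm U \<phi> * ?S"
      using bound AE_space
    proof eventually_elim
      case (elim t)
      have "ennreal (cmod (?\<Phi> t)) \<le> functional_norm U \<phi> * sup_norm U (\<lambda>z. f z t)"
        by (rule cmod_functional_le[OF assms(8) assms(6)[OF elim(2)]])
      also have "\<dots> \<le> functional_norm U \<phi> * ?S"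
        unfolding C[symmetric] using elim(1) by (intro mult_left_mono sup_norm_le) auto
      finally show ?case .
    qed
  qed
  have \<Phi>closure: "?\<Phi> \<in> Linf_weak_topology M closure_of complex_span (f ` U)"
  proof (rule Linf_weak_closureI[OF _ uLinf \<Phi>Linf close null])
    show "u k \<in> complex_span (f ` U)" for k
      unfolding u_def by (rule sum_in_complex_span[OF Z])
  qed
  have \<Phi>int: "integrable M (\<lambda>t. ?\<Phi> t * g t)" if g: "integrable M g" for g
    using integrable_bounded_mult(1)[OF \<Phi>m _ g] Linf_AE_bound[OF \<Phi>Linf] by blast
  have dual: "(\<integral>t. ?\<Phi> t * g t \<partial>M) = \<phi> (\<lambda>z. \<integral>t. f z t * g t \<partial>M)" if g: "integrable M g" for g
  proof (rule LIMSEQ_unique)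
    have fg: "integrable M (\<lambda>t. f z t * g t)" if "z \<in> U" for z
      by (rule integrable_holomorphic_family(1)[OF fam that g])
    have "(\<integral>t. u k t * g t \<partial>M) = (\<Sum>z\<in>Z k. c k z * (\<integral>t. f z t * g t \<partial>M))" for k
    proof -
      have "(\<integral>t. u k t * g t \<partial>M) = (\<integral>t. (\<Sum>z\<in>Z k. c k z * (f z t * g t)) \<partial>M)"
        by (simp add: u_def sum_distrib_right mult.assoc)
      also have "\<dots> = (\<Sum>z\<in>Z k. (\<integral>t. c k z * (f z t * g t) \<partial>M))"
        by (rule Bochner_Integration.integral_sum) (use Z fg in \<open>auto intro!: integrable_mult_right\<close>)
      finally show ?thesis by simp
    qed
    then show "(\<lambda>k. \<integral>t. u k t * g t \<partial>M) \<longlonglongrightarrow> \<phi> (\<lambda>z. \<integral>t. f z t * g t \<partial>M)"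
      using conv[OF GH[OF g]] by simp
    show "(\<lambda>k. \<integral>t. u k t * g t \<partial>M) \<longlonglongrightarrow> (\<integral>t. ?\<Phi> t * g t \<partial>M)"
      using Linf_integral_tendsto[OF uLinf \<Phi>Linf close null g] .
  qed
  have "f \<in> Hinf_Linf M U"
    unfolding Hinf_Linf_def using fLinf has_Linf_derivative_family[OF fam] assms(5) by blast
  moreover have "AE t in M. Linf_Dmulti M \<alpha> f a t = Dmulti \<alpha> (\<lambda>z. f z t) a"
    by (rule Linf_Dmulti_family[OF fam fLinf assms(7)])
  moreover have "\<forall>g :: 'a \<Rightarrow> complex. integrable M g \<longrightarrow>
       (\<forall>z\<in>U. integrable M (\<lambda>t. f z t * g t)) \<and>
       holomorphic_several U (\<lambda>z. \<integral>t. f z t * g t \<partial>M) \<and>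
       integrable M (\<lambda>t. Dmulti \<alpha> (\<lambda>z. f z t) a * g t) \<and>
       Dmulti \<alpha> (\<lambda>z. \<integral>t. f z t * g t \<partial>M) a = (\<integral>t. Dmulti \<alpha> (\<lambda>z. f z t) a * g t \<partial>M)"
    by (intro allI impI conjI ballI integrable_holomorphic_family(1)[OF fam]
        holomorphic_several_integral_family[OF fam] Dmulti_integral_family[OF fam _ assms(7)])
  moreover have "\<forall>g :: 'a \<Rightarrow> complex. integrable M g \<longrightarrow>
       integrable M (\<lambda>t. ?\<Phi> t * g t) \<and>
       (\<lambda>z. \<integral>t. f z t * g t \<partial>M) \<in> Hinf U \<and>
       (\<integral>t. ?\<Phi> t * g t \<partial>M) = \<phi> (\<lambda>z. \<integral>t. f z t * g t \<partial>M)"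
    by (intro allI impI conjI \<Phi>int GH dual)
  ultimately show ?thesis
    by (intro conjI \<Phi>Linf \<Phi>norm \<Phi>closure)
qed

end
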